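(* Let $T>0$ and let $X=(X_t)_{t\in[0,T]}$ be the (càdlàg) strong solution of $$dX_t=b(t,X_t)\,dt+\sigma(t,X_t)\,dW_t+\kappa(t)\,dL_t,\qquad X_0=x\in\mathbb{R},$$ where $\kappa:[0,T]\to\mathbb{R}$ is a bounded deterministic measurable function and $b$ is globally Lipschitz in the state variable (uniformly in time). Assume that there exists $\delta\in(0,T)$ such that $\sigma(t,y)=0$ for a.e. $t\in[0,\delta]$ and all $y\in\mathbb{R}$, and $\kappa(t)=0$ for a.e. $t\in[0,\delta]$. Let $m_0$ be the (deterministic) value of $\sup_{0\le s\le\delta}X_s$, let $Y:=\sup_{\delta\le s\le T}X_s$ and $X^{\ast}_T:=\sup_{0\le s\le T}X_s$. Then the law of $X^{\ast}_T$ is supported on $[m_0,\infty)$, and if $Y$ admits a Lebesgue density $f_Y$, then $$\mathcal{L}(X^{\ast}_T)=\mathbb{P}(Y\le m_0)\,\delta_{m_0}+f_Y(y)\,\mathbf{1}_{(m_0,\infty)}(y)\,dy,$$ where $\mathcal{L}(X^{\ast}_T)$ is the law of $X^{\ast}_T$ and $\delta_{m_0}$ is the Dirac measure at $m_0$.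
   Context: $(\Omega,\mathcal{F},(\mathcal{F}_t)_{t\in[0,T]},\mathbb{P})$ is a filtered probability space supporting a standard Brownian motion $W$ and an independent pure-jump Lévy process $L$ with Lévy measure $\nu$ on $\mathbb{R}\setminus\{0\}$. $N(dt,dz)$ is the Poisson random measure of the jumps of $L$ (intensity $dt\,\nu(dz)$), $\tilde N(dt,dz)=N(dt,dz)-\nu(dz)\,dt$, and $$L_t=\int_0^t\int_{|z|\le 1} z\,\tilde N(ds,dz)+\int_0^t\int_{|z|>1} z\,N(ds,dz).$$ *)

theory Defs
  imports "HOL-Probability.Probability"
begin

text \<open>Processes are indexed by all reals, but only their values at times in [0,T] matter.\<close>

definition cadlag_on :: "real \<Rightarrow> (real \<Rightarrow> real) \<Rightarrow> bool" where
  "cadlag_on T f \<longleftrightarrow>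
     (\<forall>t\<in>{0..<T}. (f \<longlongrightarrow> f t) (at_right t)) \<and>
     (\<forall>t\<in>{0<..T}. \<exists>l. (f \<longlongrightarrow> l) (at_left t))"

definition filtered_prob_space :: "'a measure \<Rightarrow> real \<Rightarrow> (real \<Rightarrow> 'a measure) \<Rightarrow> bool" where
  "filtered_prob_space M T F \<longleftrightarrow>
     prob_space M \<and>
     (\<forall>t\<in>{0..T}. subalgebra M (F t)) \<and>
     (\<forall>s\<in>{0..T}. \<forall>t\<in>{0..T}. s \<le> t \<longrightarrow> sets (F s) \<subseteq> sets (F t))"

definition adapted_on :: "real \<Rightarrow> (real \<Rightarrow> 'a measure) \<Rightarrow> (real \<Rightarrow> 'a \<Rightarrow> real) \<Rightarrow> bool" where
  "adapted_on T F X \<longleftrightarrow> (\<forall>t\<in>{0..T}. X t \<in> borel_measurable (F t))"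

definition independent_increments ::
  "'a measure \<Rightarrow> real \<Rightarrow> (real \<Rightarrow> 'a measure) \<Rightarrow> (real \<Rightarrow> 'a \<Rightarrow> real) \<Rightarrow> bool" where
  "independent_increments M T F X \<longleftrightarrow>
     (\<forall>s\<in>{0..T}. \<forall>t\<in>{0..T}. s < t \<longrightarrow>
        prob_space.indep_set M (sets (F s))
          (sets (vimage_algebra (space M) (\<lambda>\<omega>. X t \<omega> - X s \<omega>) borel)))"

definition brownian_motion ::
  "'a measure \<Rightarrow> real \<Rightarrow> (real \<Rightarrow> 'a measure) \<Rightarrow> (real \<Rightarrow> 'a \<Rightarrow> real) \<Rightarrow> bool" where
  "brownian_motion M T F W \<longleftrightarrow>
     adapted_on T F W \<and>
     (\<forall>\<omega>\<in>space M. W 0 \<omega> = 0) \<and>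
     (\<forall>\<omega>\<in>space M. continuous_on {0..T} (\<lambda>t. W t \<omega>)) \<and>
     independent_increments M T F W \<and>
     (\<forall>s\<in>{0..T}. \<forall>t\<in>{0..T}. s < t \<longrightarrow>
        distributed M lborel (\<lambda>\<omega>. W t \<omega> - W s \<omega>) (normal_density 0 (sqrt (t - s))))"

definition levy_process ::
  "'a measure \<Rightarrow> real \<Rightarrow> (real \<Rightarrow> 'a measure) \<Rightarrow> (real \<Rightarrow> 'a \<Rightarrow> real) \<Rightarrow> bool" where
  "levy_process M T F L \<longleftrightarrow>
     adapted_on T F L \<and>
     (\<forall>\<omega>\<in>space M. L 0 \<omega> = 0) \<and>
     (\<forall>\<omega>\<in>space M. cadlag_on T (\<lambda>t. L t \<omega>)) \<and>
     independent_increments M T F L \<and>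
     (\<forall>s\<in>{0..T}. \<forall>t\<in>{0..T}. s < t \<longrightarrow>
        distr M borel (\<lambda>\<omega>. L t \<omega> - L s \<omega>) = distr M borel (L (t - s)))"

text \<open>A measure on \<open>\<real> - {0}\<close> is a Borel measure on the line without mass at 0.\<close>

definition levy_measure :: "real measure \<Rightarrow> bool" where
  "levy_measure \<nu> \<longleftrightarrow>
     sets \<nu> = sets borel \<and> emeasure \<nu> {0} = 0 \<and>
     (\<integral>\<^sup>+z. ennreal (min 1 (z\<^sup>2)) \<partial>\<nu>) < \<infinity>"

definition jump :: "(real \<Rightarrow> real) \<Rightarrow> real \<Rightarrow> real" where
  "jump f t = f t - Lim (at_left t) f"

text \<open>The measure \<open>N(dt,dz)\<close>: a Borel set of pairs is mapped to the number of jump times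
  \<open>s \<in> (0,T]\<close> for which it contains \<open>(s, \<Delta>L\<^sub>s)\<close>.\<close>

definition jump_measure :: "real \<Rightarrow> (real \<Rightarrow> 'a \<Rightarrow> real) \<Rightarrow> 'a \<Rightarrow> (real \<times> real) measure" where
  "jump_measure T L \<omega> =
     distr (count_space {s \<in> {0<..T}. jump (\<lambda>t. L t \<omega>) s \<noteq> 0}) borel
       (\<lambda>s. (s, jump (\<lambda>t. L t \<omega>) s))"

definition poisson_random_measure ::
  "'a measure \<Rightarrow> ('a \<Rightarrow> 'b measure) \<Rightarrow> 'b measure \<Rightarrow> bool" where
  "poisson_random_measure M N \<mu> \<longleftrightarrow>
     (\<forall>\<omega>\<in>space M. sets (N \<omega>) = sets \<mu>) \<and>
     (\<forall>A\<in>sets \<mu>. (\<lambda>\<omega>. emeasure (N \<omega>) A) \<in> borel_measurable M) \<and>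
     (\<forall>A\<in>sets \<mu>. emeasure \<mu> A < \<infinity> \<longrightarrow>
        (\<forall>k::nat. measure M {\<omega>\<in>space M. emeasure (N \<omega>) A = of_nat k} =
           measure \<mu> A ^ k / fact k * exp (- measure \<mu> A))) \<and>
     (\<forall>A\<in>sets \<mu>. emeasure \<mu> A = \<infinity> \<longrightarrow> (AE \<omega> in M. emeasure (N \<omega>) A = \<infinity>)) \<and>
     (\<forall>(n::nat) A. A ` {..<n} \<subseteq> sets \<mu> \<and> disjoint_family_on A {..<n} \<longrightarrow>
        prob_space.indep_vars M (\<lambda>_. borel) (\<lambda>i \<omega>. emeasure (N \<omega>) (A i)) {..<n})"

definition tendsto_in_prob ::
  "'a measure \<Rightarrow> ('i \<Rightarrow> 'a \<Rightarrow> real) \<Rightarrow> ('a \<Rightarrow> real) \<Rightarrow> 'i filter \<Rightarrow> bool" where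
  "tendsto_in_prob M Z Y G \<longleftrightarrow>
     (\<forall>\<^sub>F i in G. Z i \<in> borel_measurable M) \<and> Y \<in> borel_measurable M \<and>
     (\<forall>\<eta>>0. ((\<lambda>i. measure M {\<omega>\<in>space M. \<bar>Z i \<omega> - Y \<omega>\<bar> > \<eta>}) \<longlongrightarrow> 0) G)"

text \<open>\<open>compensated_integral M T F N \<nu> g J\<close>: \<open>J\<close> is a cadlag adapted version of
  \<open>\<integral>\<^sub>0\<^sup>t \<integral>\<^bsub>|z| \<le> 1\<^esub> g(s,z) (N(ds,dz) - \<nu>(dz) ds)\<close> for a deterministic integrand \<open>g\<close>. The part of this
  integral over the jumps of size in \<open>(\<epsilon>,1]\<close> is a difference of ordinary integrals (only finitely
  many jumps and finite \<open>\<nu>\<close>-mass), and the integral is the limit as \<open>\<epsilon>\<close> decreases to 0.\<close>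

definition truncated_compensated_integral ::
  "(real \<times> real) measure \<Rightarrow> real measure \<Rightarrow> (real \<Rightarrow> real \<Rightarrow> real) \<Rightarrow> real \<Rightarrow> real \<Rightarrow> real" where
  "truncated_compensated_integral N\<^sub>0 \<nu> g \<epsilon> t =
     (LINT p:({0<..t} \<times> {z. \<epsilon> < \<bar>z\<bar> \<and> \<bar>z\<bar> \<le> 1})|N\<^sub>0. g (fst p) (snd p)) -
     (LINT p:({0<..t} \<times> {z. \<epsilon> < \<bar>z\<bar> \<and> \<bar>z\<bar> \<le> 1})|(lborel \<Otimes>\<^sub>M \<nu>). g (fst p) (snd p))"

definition compensated_integral ::
  "'a measure \<Rightarrow> real \<Rightarrow> (real \<Rightarrow> 'a measure) \<Rightarrow> ('a \<Rightarrow> (real \<times> real) measure) \<Rightarrow> real measure \<Rightarrow>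
   (real \<Rightarrow> real \<Rightarrow> real) \<Rightarrow> (real \<Rightarrow> 'a \<Rightarrow> real) \<Rightarrow> bool" where
  "compensated_integral M T F N \<nu> g J \<longleftrightarrow>
     adapted_on T F J \<and>
     (\<forall>\<omega>\<in>space M. cadlag_on T (\<lambda>t. J t \<omega>)) \<and>
     (\<forall>t\<in>{0..T}.
        tendsto_in_prob M (\<lambda>\<epsilon> \<omega>. truncated_compensated_integral (N \<omega>) \<nu> g \<epsilon> t) (J t) (at_right 0))"

definition driver_filtration ::
  "'a measure \<Rightarrow> (real \<Rightarrow> 'a \<Rightarrow> real) \<Rightarrow> (real \<Rightarrow> 'a \<Rightarrow> real) \<Rightarrow> real \<Rightarrow> 'a measure" where
  "driver_filtration M W L t =
     sigma (space M)
       ((\<Union>s\<in>{0..t}. sets (vimage_algebra (space M) (W s) borel) \<union>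
                     sets (vimage_algebra (space M) (L s) borel)) \<union> null_sets M)"

text \<open>\<open>is_levy_integral M T F \<nu> L k Z\<close>: up to indistinguishability \<open>Z\<^sub>t\<close> is \<open>\<integral>\<^sub>0\<^sup>t k(s) dL\<^sub>s\<close>
  for deterministic \<open>k\<close>, with \<open>dL\<close> split into compensated small jumps and large jumps.\<close>

definition is_levy_integral ::
  "'a measure \<Rightarrow> real \<Rightarrow> (real \<Rightarrow> 'a measure) \<Rightarrow> real measure \<Rightarrow> (real \<Rightarrow> 'a \<Rightarrow> real) \<Rightarrow>
   (real \<Rightarrow> real) \<Rightarrow> (real \<Rightarrow> 'a \<Rightarrow> real) \<Rightarrow> bool" where
  "is_levy_integral M T F \<nu> L k Z \<longleftrightarrow>
     (\<exists>J. compensated_integral M T F (jump_measure T L) \<nu> (\<lambda>s z. k s * z) J \<and>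
        (AE \<omega> in M. \<forall>t\<in>{0..T}.
           Z t \<omega> = J t \<omega> +
             (LINT p:({0<..t} \<times> {z. 1 < \<bar>z\<bar>})|jump_measure T L \<omega>. k (fst p) * snd p)))"

text \<open>The filtration for the small-jump part of the decomposition of \<open>L\<close> is the completed one
  generated by \<open>L\<close> itself (both arguments of \<open>driver_filtration\<close> are \<open>L\<close>).\<close>

definition pure_jump_levy_process ::
  "'a measure \<Rightarrow> real \<Rightarrow> (real \<Rightarrow> 'a measure) \<Rightarrow> real measure \<Rightarrow> (real \<Rightarrow> 'a \<Rightarrow> real) \<Rightarrow> bool" where
  "pure_jump_levy_process M T F \<nu> L \<longleftrightarrow>
     levy_process M T F L \<and> levy_measure \<nu> \<and>
     poisson_random_measure M (jump_measure T L)
       (density lborel (indicator {0..T}) \<Otimes>\<^sub>M \<nu>) \<and>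
     is_levy_integral M T (driver_filtration M L L) \<nu> L (\<lambda>_. 1) L"

definition progressive_on :: "real \<Rightarrow> (real \<Rightarrow> 'a measure) \<Rightarrow> (real \<Rightarrow> 'a \<Rightarrow> real) \<Rightarrow> bool" where
  "progressive_on T F H \<longleftrightarrow>
     (\<forall>t\<in>{0..T}. (\<lambda>(s, \<omega>). H s \<omega>) \<in> borel_measurable (restrict_space borel {0..t} \<Otimes>\<^sub>M F t))"

text \<open>A simple integrand is \<open>\<Sum>i<n. \<xi>\<^sub>i 1\<^bsub>(\<tau>\<^sub>i,\<tau>\<^sub>i\<^sub>+\<^sub>1]\<^esub>\<close> with bounded \<open>F\<^bsub>\<tau>\<^sub>i\<^esub>\<close>-measurable \<open>\<xi>\<^sub>i\<close>.\<close>

definition simple_integrand ::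
  "'a measure \<Rightarrow> real \<Rightarrow> (real \<Rightarrow> 'a measure) \<Rightarrow> nat \<Rightarrow> (nat \<Rightarrow> real) \<Rightarrow> (nat \<Rightarrow> 'a \<Rightarrow> real) \<Rightarrow> bool" where
  "simple_integrand M T F n \<tau> \<xi> \<longleftrightarrow>
     \<tau> ` {..n} \<subseteq> {0..T} \<and> mono_on {..n} \<tau> \<and>
     (\<forall>i<n. \<xi> i \<in> borel_measurable (F (\<tau> i)) \<and> bounded (\<xi> i ` space M))"

definition simple_process ::
  "nat \<Rightarrow> (nat \<Rightarrow> real) \<Rightarrow> (nat \<Rightarrow> 'a \<Rightarrow> real) \<Rightarrow> real \<Rightarrow> 'a \<Rightarrow> real" where
  "simple_process n \<tau> \<xi> s \<omega> = (\<Sum>i<n. \<xi> i \<omega> * indicator {\<tau> i<..\<tau> (Suc i)} s)"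

definition simple_integral ::
  "(real \<Rightarrow> 'a \<Rightarrow> real) \<Rightarrow> nat \<Rightarrow> (nat \<Rightarrow> real) \<Rightarrow> (nat \<Rightarrow> 'a \<Rightarrow> real) \<Rightarrow> real \<Rightarrow> 'a \<Rightarrow> real" where
  "simple_integral W n \<tau> \<xi> t \<omega> =
     (\<Sum>i<n. \<xi> i \<omega> * (W (min t (\<tau> (Suc i))) \<omega> - W (min t (\<tau> i)) \<omega>))"

text \<open>\<open>is_ito_integral M T F W H I\<close>: \<open>I\<close> is a continuous adapted version of \<open>\<integral>\<^sub>0\<^sup>t H\<^sub>s dW\<^sub>s\<close> on [0,T],
  for progressively measurable \<open>H\<close> with \<open>\<integral>\<^sub>0\<^sup>T H\<^sub>s\<^sup>2 ds < \<infinity>\<close> almost surely.\<close>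

definition is_ito_integral ::
  "'a measure \<Rightarrow> real \<Rightarrow> (real \<Rightarrow> 'a measure) \<Rightarrow> (real \<Rightarrow> 'a \<Rightarrow> real) \<Rightarrow>
   (real \<Rightarrow> 'a \<Rightarrow> real) \<Rightarrow> (real \<Rightarrow> 'a \<Rightarrow> real) \<Rightarrow> bool" where
  "is_ito_integral M T F W H I \<longleftrightarrow>
     progressive_on T F H \<and>
     (AE \<omega> in M. set_integrable lborel {0..T} (\<lambda>s. (H s \<omega>)\<^sup>2)) \<and>
     adapted_on T F I \<and>
     (\<forall>\<omega>\<in>space M. continuous_on {0..T} (\<lambda>t. I t \<omega>)) \<and>
     (\<exists>n \<tau> \<xi>.
        (\<forall>k::nat. simple_integrand M T F (n k) (\<tau> k) (\<xi> k)) \<and>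
        tendsto_in_prob M
          (\<lambda>k \<omega>. LINT s:{0..T}|lborel. (simple_process (n k) (\<tau> k) (\<xi> k) s \<omega> - H s \<omega>)\<^sup>2)
          (\<lambda>_. 0) sequentially \<and>
        (\<forall>t\<in>{0..T}.
           tendsto_in_prob M (\<lambda>k. simple_integral W (n k) (\<tau> k) (\<xi> k) t) (I t) sequentially))"

text \<open>A strong solution is adapted to the completed filtration generated by the driving noise.\<close>

definition strong_solution ::
  "'a measure \<Rightarrow> real \<Rightarrow> (real \<Rightarrow> 'a \<Rightarrow> real) \<Rightarrow> (real \<Rightarrow> 'a \<Rightarrow> real) \<Rightarrow> real measure \<Rightarrow>
   (real \<Rightarrow> real \<Rightarrow> real) \<Rightarrow> (real \<Rightarrow> real \<Rightarrow> real) \<Rightarrow> (real \<Rightarrow> real) \<Rightarrow> real \<Rightarrow>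
   (real \<Rightarrow> 'a \<Rightarrow> real) \<Rightarrow> bool" where
  "strong_solution M T W L \<nu> b \<sigma> \<kappa> x X \<longleftrightarrow>
     adapted_on T (driver_filtration M W L) X \<and>
     (\<forall>\<omega>\<in>space M. cadlag_on T (\<lambda>t. X t \<omega>)) \<and>
     (AE \<omega> in M. set_integrable lborel {0..T} (\<lambda>s. b s (X s \<omega>))) \<and>
     (\<exists>I Z.
        is_ito_integral M T (driver_filtration M W L) W (\<lambda>s \<omega>. \<sigma> s (X s \<omega>)) I \<and>
        is_levy_integral M T (driver_filtration M W L) \<nu> L \<kappa> Z \<and>
        (AE \<omega> in M. \<forall>t\<in>{0..T}.
           X t \<omega> = x + (LINT s:{0..t}|lborel. b s (X s \<omega>)) + I t \<omega> + Z t \<omega>))"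

end

theory Submission
  imports Defs
begin

text \<open>On \<open>[0,\<delta>]\<close> both stochastic integrals vanish almost surely, so almost every path solves the
  integral equation \<open>X\<^sub>t = x + \<integral>\<^sub>0\<^sup>t b(s, X\<^sub>s) ds\<close> there; as \<open>b\<close> is Lipschitz, all these paths agree and
  \<open>sup\<^bsub>[0,\<delta>]\<^esub> X\<close> is a constant \<open>m\<^sub>0\<close>. Hence \<open>X\<^sup>*\<^sub>T = max m\<^sub>0 Y\<close> almost surely, and the law is read off.
  The Ito integral vanishes because \<open>P(|\<integral> S dW| > \<eta>) \<le> P(\<integral> S\<^sup>2 > c) + c / \<eta>\<^sup>2\<close> for simple \<open>S\<close>; the
  Levy integral vanishes because \<open>{\<kappa> \<noteq> 0} \<inter> [0,\<delta>]\<close> is Lebesgue null, so that almost surely no jump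
  occurs at any of its times.\<close>

section \<open>Cadlag paths and limits in probability\<close>

text \<open>Two mismatches shape the argument. The solution and its integrals live on the completed
  filtration generated by \<open>W\<close> and \<open>L\<close>, while \<open>W\<close> is a
  Brownian motion for \<open>F\<close>, which may lack the null sets; independence of increments is
  therefore carried over to the generated filtration. And the Ito integral is given only as a limit
  in probability of simple integrals, whose integrands need not vanish on the initial interval.
  Their energy there is dominated by the approximation error, which is small in probability with no
  control in mean, so the isometry cannot be applied directly; cutting an integrand off at energy
  \<open>c\<close> repairs this. Both integrals are identified with 0 at one fixed time after
  another, so the exceptional null set depends on the time. Path regularity reduces an interval to
  countably many times and yields one null set for all of them; the same reduction makes the running
  supremum measurable.\<close>

lemma cadlag_on_bounded:
  assumes f: "cadlag_on T f"
  shows "bounded (f ` {0..T})"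
proof -
  have loc: "\<exists>U B. open U \<and> t \<in> U \<and> (\<forall>s\<in>U \<inter> {0..T}. \<bar>f s\<bar> \<le> B)" if t: "t \<in> {0..T}" for t
  proof -
    \<comment> \<open>At \<open>t = 0\<close> no left limit is available, but all times to the left
      lie outside the interval and any bound will do; the right end \<open>T\<close> is treated in
      the same way.\<close>
    have "\<exists>B. \<forall>\<^sub>F s in at_left t. s \<in> {0..T} \<longrightarrow> \<bar>f s\<bar> \<le> B"
    proof (cases "t = 0")
      case True
      have "\<forall>\<^sub>F s in at_left t. s < t"
        by (simp add: eventually_at_filter)
      then show ?thesis
        using True by (intro exI[of _ 0]) (auto elim!: eventually_mono)
    next
      case False
      then obtain l where "(f \<longlongrightarrow> l) (at_left t)"
        using f t unfolding cadlag_on_def by force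
      then have "\<forall>\<^sub>F s in at_left t. dist (f s) l < 1"
        by (rule tendstoD) simp
      then have "\<forall>\<^sub>F s in at_left t. s \<in> {0..T} \<longrightarrow> \<bar>f s\<bar> \<le> \<bar>l\<bar> + 1"
        by eventually_elim (auto simp: dist_real_def)
      then show ?thesis by blast
    qed
    then obtain B1 where B1: "\<forall>\<^sub>F s in at_left t. s \<in> {0..T} \<longrightarrow> \<bar>f s\<bar> \<le> B1" by blast
    have "\<exists>B. \<forall>\<^sub>F s in at_right t. s \<in> {0..T} \<longrightarrow> \<bar>f s\<bar> \<le> B"
    proof (cases "t = T")
      case True
      have "\<forall>\<^sub>F s in at_right t. s > t"
        by (simp add: eventually_at_filter)
      then show ?thesis
        using True by (intro exI[of _ 0]) (auto elim!: eventually_mono)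
    next
      case False
      then have "(f \<longlongrightarrow> f t) (at_right t)"
        using f t unfolding cadlag_on_def by force
      then have "\<forall>\<^sub>F s in at_right t. dist (f s) (f t) < 1"
        by (rule tendstoD) simp
      then have "\<forall>\<^sub>F s in at_right t. s \<in> {0..T} \<longrightarrow> \<bar>f s\<bar> \<le> \<bar>f t\<bar> + 1"
        by eventually_elim (auto simp: dist_real_def)
      then show ?thesis by blast
    qed
    then obtain B2 where B2: "\<forall>\<^sub>F s in at_right t. s \<in> {0..T} \<longrightarrow> \<bar>f s\<bar> \<le> B2" by blast
    \<comment> \<open>The one-sided bounds say nothing about the value at \<open>t\<close> itself,
      so it enters the maximum.\<close>
    define B where "B = max \<bar>f t\<bar> (max B1 B2)"
    have "\<forall>\<^sub>F s in at t. s \<in> {0..T} \<longrightarrow> \<bar>f s\<bar> \<le> B"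
      unfolding eventually_at_split using B1 B2
      by (auto elim!: eventually_mono simp: B_def)
    then obtain U where "open U" "t \<in> U" "\<forall>s\<in>U. s \<noteq> t \<longrightarrow> s \<in> {0..T} \<longrightarrow> \<bar>f s\<bar> \<le> B"
      unfolding eventually_at_topological by blast
    moreover have "\<bar>f t\<bar> \<le> B" by (simp add: B_def)
    ultimately show ?thesis by (metis IntD1 IntD2)
  qed
  then obtain U B where UB: "\<And>t. t \<in> {0..T} \<Longrightarrow>
      open (U t) \<and> t \<in> U t \<and> (\<forall>s\<in>U t \<inter> {0..T}. \<bar>f s\<bar> \<le> B t)"
    by metis
  obtain D where D: "D \<subseteq> {0..T}" "finite D" "{0..T} \<subseteq> (\<Union>t\<in>D. U t)"
    by (rule compactE_image[OF compact_Icc[of 0 T], of "{0..T}" U]) (use UB in auto)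
  \<comment> \<open>A sum replaces the maximum of the local bounds, so that an empty cover needs no
    separate case.\<close>
  have "\<bar>f s\<bar> \<le> (\<Sum>t\<in>D. \<bar>B t\<bar>)" if s: "s \<in> {0..T}" for s
  proof -
    obtain t where t: "t \<in> D" "s \<in> U t" using D s by auto
    then have "\<bar>f s\<bar> \<le> B t" using UB D s by blast
    also have "\<dots> \<le> \<bar>B t\<bar>" by simp
    also have "\<dots> \<le> (\<Sum>t\<in>D. \<bar>B t\<bar>)"
      by (rule member_le_sum) (use t D in auto)
    finally show ?thesis .
  qed
  then show ?thesis unfolding bounded_iff by force
qed

text \<open>Right continuity recovers a value from rational times further to the right; inside the
  interval there are none beyond \<open>c\<close>, hence \<open>c\<close> is added by hand.\<close>

definition dense_times :: "real \<Rightarrow> real \<Rightarrow> real set" where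
  "dense_times a c = insert c ({a..c} \<inter> \<rat>)"

lemma countable_dense_times: "countable (dense_times a c)"
  unfolding dense_times_def by (simp add: countable_rat countable_Int2)

lemma dense_times_subset: "a \<le> c \<Longrightarrow> dense_times a c \<subseteq> {a..c}"
  unfolding dense_times_def by auto

lemma dense_times_nonempty: "dense_times a c \<noteq> {}"
  unfolding dense_times_def by simp

text \<open>Leaving a closed set is an open condition, so by right continuity it would persist up to
  some rational time. Half-lines as \<open>C\<close> serve the suprema, the set \<open>{0}\<close>
  serves the vanishing of integrals.\<close>

lemma cadlag_on_closed_dense:
  assumes f: "cadlag_on T f" and ac: "0 \<le> a" "c \<le> T" and C: "closed C"
    and D: "\<And>s. s \<in> dense_times a c \<Longrightarrow> f s \<in> C" and s: "s \<in> {a..c}"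
  shows "f s \<in> C"
proof (rule ccontr)
  assume n: "f s \<notin> C"
  then have sc: "s < c" using D[of c] s by (cases "s = c") (auto simp: dense_times_def)
  then have "(f \<longlongrightarrow> f s) (at_right s)" using f s ac unfolding cadlag_on_def by auto
  then have "\<forall>\<^sub>F u in at_right s. f u \<in> - C"
    by (rule topological_tendstoD) (use C n in auto)
  then obtain b where b: "b > s" "\<And>u. s < u \<Longrightarrow> u < b \<Longrightarrow> f u \<notin> C"
    unfolding eventually_at_right_field by auto
  obtain u where u: "u \<in> \<rat>" "s < u" "u < min b c"
    using Rats_dense_in_real[of s "min b c"] b sc by auto
  then show False using b(2)[of u] D[of u] s by (auto simp: dense_times_def)
qed

lemma cadlag_on_SUP_dense:
  assumes f: "cadlag_on T f" and ac: "0 \<le> a" "a \<le> c" "c \<le> T"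
  shows "(SUP s\<in>{a..c}. f s) = (SUP s\<in>dense_times a c. f s)"
proof (rule antisym)
  have bdd: "bdd_above (f ` {a..c})"
    using ac
    by (intro bounded_imp_bdd_above bounded_subset[OF cadlag_on_bounded[OF f]] image_mono) auto
  have bdd': "bdd_above (f ` dense_times a c)"
    by (rule bdd_above_mono[OF bdd]) (use dense_times_subset ac in auto)
  show "(SUP s\<in>dense_times a c. f s) \<le> (SUP s\<in>{a..c}. f s)"
    by (rule cSUP_subset_mono[OF dense_times_nonempty bdd]) (use dense_times_subset ac in auto)
  show "(SUP s\<in>{a..c}. f s) \<le> (SUP s\<in>dense_times a c. f s)"
  proof (rule cSUP_least)
    fix s assume s: "s \<in> {a..c}"
    have "f u \<in> {..(SUP s\<in>dense_times a c. f s)}" if "u \<in> dense_times a c" for u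
      using cSUP_upper[OF that bdd'] by simp
    from cadlag_on_closed_dense[OF f ac(1,3) closed_atMost this s]
    show "f s \<le> (SUP s\<in>dense_times a c. f s)" by simp
  qed (use ac in auto)
qed

lemma borel_measurable_SUP_cadlag:
  assumes X: "\<And>s. s \<in> {a..c} \<Longrightarrow> X s \<in> borel_measurable M"
    and cad: "\<And>\<omega>. \<omega> \<in> space M \<Longrightarrow> cadlag_on T (\<lambda>t. X t \<omega>)"
    and ac: "0 \<le> a" "a \<le> c" "c \<le> T"
  shows "(\<lambda>\<omega>. SUP s\<in>{a..c}. X s \<omega> :: real) \<in> borel_measurable M"
proof -
  have "(\<lambda>\<omega>. SUP s\<in>dense_times a c. X s \<omega>) \<in> borel_measurable M"
  proof (rule borel_measurable_cSUP[OF countable_dense_times])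
    fix \<omega> assume "\<omega> \<in> space M"
    show "bdd_above ((\<lambda>s. X s \<omega>) ` dense_times a c)"
      using dense_times_subset[OF ac(2)] ac
      by (intro bounded_imp_bdd_above bounded_subset[OF cadlag_on_bounded[OF cad[OF \<open>\<omega> \<in> space M\<close>]]]
          image_mono) auto
  qed (use X dense_times_subset[OF ac(2)] in auto)
  then show ?thesis
    by (subst measurable_cong[OF cadlag_on_SUP_dense[OF cad ac]])
qed

text \<open>Countably many of the time-dependent null sets are united, and right continuity covers
  the remaining times.\<close>

lemma AE_cadlag_zero:
  assumes J: "\<And>t. t \<in> {a..c} \<Longrightarrow> AE \<omega> in M. J t \<omega> = (0::real)"
    and cad: "\<And>\<omega>. \<omega> \<in> space M \<Longrightarrow> cadlag_on T (\<lambda>t. J t \<omega>)"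
    and ac: "0 \<le> a" "a \<le> c" "c \<le> T"
  shows "AE \<omega> in M. \<forall>t\<in>{a..c}. J t \<omega> = 0"
proof -
  have "AE \<omega> in M. \<forall>t\<in>dense_times a c. J t \<omega> = 0"
    using J dense_times_subset[OF ac(2)] by (subst AE_ball_countable[OF countable_dense_times]) auto
  then show ?thesis
  proof (rule AE_mp, intro AE_I2 impI ballI)
    fix \<omega> t assume "\<omega> \<in> space M" "\<forall>t\<in>dense_times a c. J t \<omega> = 0" "t \<in> {a..c}"
    then show "J t \<omega> = 0"
      using cadlag_on_closed_dense[OF cad ac(1,3), of \<omega> "{0}" t] by auto
  qed
qed

lemma continuous_on_imp_cadlag_on:
  assumes "continuous_on {0..T} f"
  shows "cadlag_on T f"
proof -
  have *: "(f \<longlongrightarrow> f t) (at t within {0..T})" if "t \<in> {0..T}" for t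
    using assms that unfolding continuous_on_def by blast
  have "(f \<longlongrightarrow> f t) (at_right t)" if "t \<in> {0..<T}" for t
  proof -
    have "(f \<longlongrightarrow> f t) (at t within {t..T})"
      by (rule tendsto_within_subset[OF *]) (use that in auto)
    then show ?thesis using that by (simp add: at_within_Icc_at_right)
  qed
  moreover have "(f \<longlongrightarrow> f t) (at_left t)" if "t \<in> {0<..T}" for t
  proof -
    have "(f \<longlongrightarrow> f t) (at t within {0..t})"
      by (rule tendsto_within_subset[OF *]) (use that in auto)
    then show ?thesis using that by (simp add: at_within_Icc_at_left)
  qed
  ultimately show ?thesis unfolding cadlag_on_def by blast
qed

text \<open>If \<open>Y\<close> exceeds \<open>2 * \<eta>\<close> in modulus, then
  \<open>Z i - Y\<close> or \<open>Z i\<close> exceeds \<open>\<eta>\<close>, and both events become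
  negligible. The filter is arbitrary because the Ito integral is a limit along a sequence and the
  Levy integral a limit as the jump threshold decreases to 0.\<close>

lemma tendsto_in_prob_limit_zero:
  assumes M: "finite_measure M" and t: "tendsto_in_prob M Z Y G" and G: "G \<noteq> bot"
    and Z: "\<And>\<eta>. \<eta> > 0 \<Longrightarrow> ((\<lambda>i. measure M {\<omega>\<in>space M. \<bar>Z i \<omega>\<bar> > \<eta>}) \<longlongrightarrow> 0) G"
  shows "AE \<omega> in M. Y \<omega> = 0"
proof -
  interpret finite_measure M by fact
  have [measurable]: "Y \<in> borel_measurable M" using t unfolding tendsto_in_prob_def by blast
  have meas: "\<forall>\<^sub>F i in G. Z i \<in> borel_measurable M" using t unfolding tendsto_in_prob_def by blast
  have z: "measure M {\<omega>\<in>space M. \<bar>Y \<omega>\<bar> > 2 * \<eta>} = 0" if \<eta>: "\<eta> > 0" for \<eta>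
  proof -
    have "((\<lambda>i. measure M {\<omega>\<in>space M. \<bar>Z i \<omega> - Y \<omega>\<bar> > \<eta>}) \<longlongrightarrow> 0) G"
      using t \<eta> unfolding tendsto_in_prob_def by blast
    from tendsto_add[OF this Z[OF \<eta>]]
    have lim: "((\<lambda>i. measure M {\<omega>\<in>space M. \<bar>Z i \<omega> - Y \<omega>\<bar> > \<eta>} +
        measure M {\<omega>\<in>space M. \<bar>Z i \<omega>\<bar> > \<eta>}) \<longlongrightarrow> 0) G" by simp
    have "\<forall>\<^sub>F i in G. measure M {\<omega>\<in>space M. \<bar>Y \<omega>\<bar> > 2 * \<eta>} \<le>
        measure M {\<omega>\<in>space M. \<bar>Z i \<omega> - Y \<omega>\<bar> > \<eta>} + measure M {\<omega>\<in>space M. \<bar>Z i \<omega>\<bar> > \<eta>}"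
      using meas
    proof eventually_elim
      case (elim i)
      note [measurable] = elim
      have "measure M {\<omega>\<in>space M. \<bar>Y \<omega>\<bar> > 2 * \<eta>} \<le>
        measure M ({\<omega>\<in>space M. \<bar>Z i \<omega> - Y \<omega>\<bar> > \<eta>} \<union> {\<omega>\<in>space M. \<bar>Z i \<omega>\<bar> > \<eta>})"
        by (rule finite_measure_mono) auto
      also have "\<dots> \<le> measure M {\<omega>\<in>space M. \<bar>Z i \<omega> - Y \<omega>\<bar> > \<eta>} +
          measure M {\<omega>\<in>space M. \<bar>Z i \<omega>\<bar> > \<eta>}"
        by (rule measure_Un_le) measurable
      finally show ?case .
    qed
    \<comment> \<open>The left side does not depend on \<open>i\<close>, so nontriviality of
      \<open>G\<close> bounds it by the limit.\<close>
    with lim have "measure M {\<omega>\<in>space M. \<bar>Y \<omega>\<bar> > 2 * \<eta>} \<le> 0"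
      by (rule tendsto_lowerbound[OF _ _ G])
    then show ?thesis by (simp add: measure_le_0_iff)
  qed
  have "AE \<omega> in M. \<forall>n::nat. \<not> \<bar>Y \<omega>\<bar> > 2 * (1 / real (Suc n))"
  proof (subst AE_all_countable, intro allI)
    fix n :: nat
    have "emeasure M {\<omega>\<in>space M. \<bar>Y \<omega>\<bar> > 2 * (1 / real (Suc n))} = 0"
      using z[of "1 / real (Suc n)"] by (simp add: emeasure_eq_measure)
    then show "AE \<omega> in M. \<not> \<bar>Y \<omega>\<bar> > 2 * (1 / real (Suc n))"
      by (subst AE_iff_measurable[OF _ refl]) auto
  qed
  then show ?thesis
  proof (rule AE_mp, intro AE_I2 impI)
    fix \<omega> assume *: "\<forall>n::nat. \<not> \<bar>Y \<omega>\<bar> > 2 * (1 / real (Suc n))"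
    show "Y \<omega> = 0"
    proof (rule ccontr)
      assume "Y \<omega> \<noteq> 0"
      then obtain n where "1 / real (Suc n) < \<bar>Y \<omega>\<bar> / 2"
        using nat_approx_posE[of "\<bar>Y \<omega>\<bar> / 2"] by auto
      then show False using *[rule_format, of n] by auto
    qed
  qed
qed

section \<open>The filtration generated by the driving noise\<close>

lemma space_driver_filtration [simp]: "space (driver_filtration M W L t) = space M"
  unfolding driver_filtration_def by (simp add: space_measure_of_conv)

lemma sets_driver_filtration:
  "sets (driver_filtration M W L t) = sigma_sets (space M)
     ((\<Union>s\<in>{0..t}. sets (vimage_algebra (space M) (W s) borel) \<union>
                     sets (vimage_algebra (space M) (L s) borel)) \<union> null_sets M)"
  unfolding driver_filtration_def
proof (rule sets_measure_of)
  show "(\<Union>s\<in>{0..t}. sets (vimage_algebra (space M) (W s) borel) \<union>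
      sets (vimage_algebra (space M) (L s) borel)) \<union> null_sets M \<subseteq> Pow (space M)"
    using sets.space_closed[of M] sets.space_closed[of "vimage_algebra (space M) _ borel"]
    unfolding space_vimage_algebra by (intro Un_least UN_least) (auto simp: null_sets_def)
qed

lemma sets_driver_filtration_mono:
  "s \<le> t \<Longrightarrow> sets (driver_filtration M W L s) \<subseteq> sets (driver_filtration M W L t)"
  unfolding sets_driver_filtration by (rule sigma_sets_mono') auto

lemma borel_measurable_vimage_algebra_sets:
  assumes f: "f \<in> borel_measurable N" and sp: "space N = S"
    and A: "A \<in> sets (vimage_algebra S f borel)"
  shows "A \<in> sets N"
proof -
  have "sets (vimage_algebra S f borel) \<subseteq> sets N"
    using f by (intro sets_image_in_sets[OF sp])
  with A show ?thesis by blast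
qed

lemma measurable_driver_filtration:
  assumes "s \<in> {0..t}"
  shows "W s \<in> borel_measurable (driver_filtration M W L t)"
proof (rule measurableI)
  fix A :: "real set" assume "A \<in> sets borel"
  then have "W s -` A \<inter> space M \<in> sets (vimage_algebra (space M) (W s) borel)"
    by (rule in_vimage_algebra)
  then show "W s -` A \<inter> space (driver_filtration M W L t) \<in> sets (driver_filtration M W L t)"
    unfolding sets_driver_filtration space_driver_filtration using assms
    by (intro sigma_sets.Basic) auto
qed simp

text \<open>Being almost surely equal to an event of \<open>F t\<close> survives complements and
  countable unions, and it holds for the generators: past values of \<open>W\<close> and
  \<open>L\<close> are adapted to \<open>F\<close>, and a null set is almost surely the empty
  set.\<close>

lemma driver_filtration_AE_eq:
  assumes fil: "filtered_prob_space M T F" and W: "adapted_on T F W" and L: "adapted_on T F L"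
    and t: "t \<in> {0..T}" and A: "A \<in> sets (driver_filtration M W L t)"
  shows "A \<in> sets M \<and> (\<exists>B\<in>sets (F t). AE \<omega> in M. \<omega> \<in> A \<longleftrightarrow> \<omega> \<in> B)"
proof -
  have sub: "space (F t) = space M" "sets (F t) \<subseteq> sets M"
    using fil t unfolding filtered_prob_space_def subalgebra_def by auto
  have spF: "space (F s) = space M" if "s \<in> {0..t}" for s
    using fil t that unfolding filtered_prob_space_def subalgebra_def by auto
  have mono: "sets (F s) \<subseteq> sets (F t)" if "s \<in> {0..t}" for s
    using fil t that unfolding filtered_prob_space_def by auto
  have meas: "W s \<in> borel_measurable (F s)" "L s \<in> borel_measurable (F s)" if "s \<in> {0..t}" for s
    using W L t that unfolding adapted_on_def by auto
  show ?thesis using A unfolding sets_driver_filtration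
  proof (induction rule: sigma_sets.induct)
    case (Basic A)
    then consider s where "s \<in> {0..t}" "A \<in> sets (vimage_algebra (space M) (W s) borel)"
      | s where "s \<in> {0..t}" "A \<in> sets (vimage_algebra (space M) (L s) borel)"
      | "A \<in> null_sets M" by blast
    then show ?case
    proof cases
      case 1
      then have "A \<in> sets (F s)"
        using borel_measurable_vimage_algebra_sets[OF meas(1) spF] by simp
      with mono[OF \<open>s \<in> {0..t}\<close>] have "A \<in> sets (F t)" by (rule subsetD)
      with sub show ?thesis by auto
    next
      case 2
      then have "A \<in> sets (F s)"
        using borel_measurable_vimage_algebra_sets[OF meas(2) spF] by simp
      with mono[OF \<open>s \<in> {0..t}\<close>] have "A \<in> sets (F t)" by (rule subsetD)
      with sub show ?thesis by auto
    next
      case 3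
      then show ?thesis using AE_not_in[OF 3] by (intro conjI bexI[of _ "{}"]) auto
    qed
  next
    case Empty
    then show ?case by (intro conjI bexI[of _ "{}"]) auto
  next
    case (Compl A)
    then obtain B where B: "A \<in> sets M" "B \<in> sets (F t)" "AE \<omega> in M. \<omega> \<in> A \<longleftrightarrow> \<omega> \<in> B" by blast
    have "space M - B \<in> sets (F t)" using B sub by (metis sets.compl_sets)
    moreover have "AE \<omega> in M. \<omega> \<in> space M - A \<longleftrightarrow> \<omega> \<in> space M - B" using B(3) by auto
    ultimately show ?case using B by blast
  next
    case (Union A)
    then obtain B where B: "\<And>i. A i \<in> sets M" "\<And>i::nat. B i \<in> sets (F t)"
      "\<And>i. AE \<omega> in M. \<omega> \<in> A i \<longleftrightarrow> \<omega> \<in> B i" by metis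
    have "(\<Union>i. B i) \<in> sets (F t)" using B by blast
    moreover have "AE \<omega> in M. \<forall>i. \<omega> \<in> A i \<longleftrightarrow> \<omega> \<in> B i" using B by (simp add: AE_all_countable)
    then have "AE \<omega> in M. \<omega> \<in> (\<Union>i. A i) \<longleftrightarrow> \<omega> \<in> (\<Union>i. B i)" by eventually_elim auto
    ultimately show ?case using B by blast
  qed
qed

lemma filtered_prob_space_driver:
  assumes fil: "filtered_prob_space M T F" and W: "adapted_on T F W" and L: "adapted_on T F L"
  shows "filtered_prob_space M T (driver_filtration M W L)"
  using fil driver_filtration_AE_eq[OF assms] sets_driver_filtration_mono[of _ _ M W L]
  unfolding filtered_prob_space_def subalgebra_def by (simp add: subset_eq)

text \<open>Independence of an event from an increment depends only on probabilities, so each event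
  of the larger filtration may be exchanged for an almost surely equal event of
  \<open>F s\<close>.\<close>

lemma brownian_motion_driver:
  assumes fil: "filtered_prob_space M T F" and W: "brownian_motion M T F W" and L: "adapted_on T F L"
  shows "brownian_motion M T (driver_filtration M W L) W"
proof -
  interpret prob_space M using fil unfolding filtered_prob_space_def by blast
  have Wa: "adapted_on T F W" and ind: "independent_increments M T F W"
    using W unfolding brownian_motion_def by auto
  have sub: "sets (F t) \<subseteq> sets M" if "t \<in> {0..T}" for t
    using fil that unfolding filtered_prob_space_def subalgebra_def by auto
  have "independent_increments M T (driver_filtration M W L) W"
    unfolding independent_increments_def
  proof (intro ballI impI)
    fix s t assume st: "s \<in> {0..T}" "t \<in> {0..T}" "s < t"
    let ?V = "sets (vimage_algebra (space M) (\<lambda>\<omega>. W t \<omega> - W s \<omega>) borel)"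
    have i: "indep_set (sets (F s)) ?V" using ind st unfolding independent_increments_def by blast
    show "indep_set (sets (driver_filtration M W L s)) ?V"
    proof (rule indep_setI)
      show V: "?V \<subseteq> events" using i by (rule indep_setD_ev2)
      show "sets (driver_filtration M W L s) \<subseteq> events"
        using driver_filtration_AE_eq[OF fil Wa L st(1)] by blast
      fix a b assume a: "a \<in> sets (driver_filtration M W L s)" and b: "b \<in> ?V"
      obtain a' where a': "a' \<in> sets (F s)" "AE \<omega> in M. \<omega> \<in> a \<longleftrightarrow> \<omega> \<in> a'" and am: "a \<in> events"
        using driver_filtration_AE_eq[OF fil Wa L st(1) a] by blast
      have a'm: "a' \<in> events" using a' sub st by blast
      have "prob (a \<inter> b) = prob (a' \<inter> b)"
        using a'(2) am a'm b V by (intro finite_measure_eq_AE) auto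
      also have "\<dots> = prob a' * prob b" by (rule indep_setD[OF i a'(1) b])
      also have "prob a' = prob a" using a'(2) am a'm by (intro finite_measure_eq_AE) auto
      finally show "prob (a \<inter> b) = prob a * prob b" .
    qed
  qed
  moreover have "adapted_on T (driver_filtration M W L) W"
    unfolding adapted_on_def by (auto intro: measurable_driver_filtration)
  ultimately show ?thesis using W unfolding brownian_motion_def by blast
qed

section \<open>Moments of Brownian increments and their independence of the past\<close>

lemma brownian_increment_moments:
  assumes fil: "filtered_prob_space M T G" and W: "brownian_motion M T G W"
    and st: "0 \<le> s" "s \<le> t" "t \<le> T"
  shows "integrable M (\<lambda>\<omega>. W t \<omega> - W s \<omega>)" (is ?A)
    and "(\<integral>\<omega>. W t \<omega> - W s \<omega> \<partial>M) = 0" (is ?B)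
    and "integrable M (\<lambda>\<omega>. (W t \<omega> - W s \<omega>)\<^sup>2)" (is ?C)
    and "(\<integral>\<omega>. (W t \<omega> - W s \<omega>)\<^sup>2 \<partial>M) = t - s" (is ?D)
proof -
  have "?A \<and> ?B \<and> ?C \<and> ?D"
  \<comment> \<open>Equal times have no normal density, yet they must be covered: truncating
    partition points at \<open>t\<close> can collapse an interval to a point.\<close>
  proof (cases "s = t")
    case False
    define c where "c = sqrt (t - s)"
    have c: "c > 0" "c\<^sup>2 = t - s" using st False by (auto simp: c_def)
    have D: "distributed M lborel (\<lambda>\<omega>. W t \<omega> - W s \<omega>) (normal_density 0 c)"
      using W st False unfolding brownian_motion_def c_def by auto
    note I = distributed_integrable[OF D] and E = distributed_integral[OF D]
    have "integrable lborel (\<lambda>x. normal_density 0 c x * x ^ k)" for k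
      using integrable_normal_moment[OF c(1), of 0 k] by simp
    from this[of 1] this[of 2] show ?thesis
      using I[of "\<lambda>x. x"] I[of "\<lambda>x. x\<^sup>2"] E[of "\<lambda>x. x"] E[of "\<lambda>x. x\<^sup>2"] c
        integral_normal_moment_odd[OF c(1), of 0 0] integral_normal_moment_even[OF c(1), of 0 1]
      by simp
  qed simp
  then show ?A ?B ?C ?D by auto
qed

lemma indep_brownian_increment:
  assumes fil: "filtered_prob_space M T G" and W: "brownian_motion M T G W"
    and st: "0 \<le> s" "s < t" "t \<le> T" and \<xi>: "\<xi> \<in> borel_measurable (G s)"
  shows "prob_space.indep_var M borel \<xi> borel (\<lambda>\<omega>. W t \<omega> - W s \<omega>)"
proof -
  interpret prob_space M using fil unfolding filtered_prob_space_def by blast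
  have sub: "subalgebra M (G u)" if "u \<in> {0..T}" for u
    using fil that unfolding filtered_prob_space_def by blast
  have sp: "space (G s) = space M" using sub[of s] st by (auto simp: subalgebra_def)
  have Wm: "W u \<in> borel_measurable M" if "u \<in> {0..T}" for u
    using W sub that unfolding brownian_motion_def adapted_on_def
    by (blast intro: measurable_from_subalg)
  have i: "indep_set (sets (G s)) (sets (vimage_algebra (space M) (\<lambda>\<omega>. W t \<omega> - W s \<omega>) borel))"
    using W st unfolding brownian_motion_def independent_increments_def by auto
  have "sigma_sets (space M) {\<xi> -` A \<inter> space M | A. A \<in> sets borel} \<subseteq> sets (G s)"
    unfolding sets_vimage_algebra[symmetric]
    using borel_measurable_vimage_algebra_sets[OF \<xi> sp] by blast
  moreover have "sigma_sets (space M) {(\<lambda>\<omega>. W t \<omega> - W s \<omega>) -` A \<inter> space M | A. A \<in> sets borel}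
      = sets (vimage_algebra (space M) (\<lambda>\<omega>. W t \<omega> - W s \<omega>) borel)"
    by (simp add: sets_vimage_algebra)
  moreover have "\<xi> \<in> borel_measurable M" using measurable_from_subalg[OF sub \<xi>] st by auto
  moreover have "(\<lambda>\<omega>. W t \<omega> - W s \<omega>) \<in> borel_measurable M" using Wm st by auto
  ultimately show ?thesis using i unfolding indep_var_eq indep_sets2_eq by blast
qed

text \<open>Independence factors both expectations. In the isometry the first-moment part removes
  the cross terms and the second-moment part evaluates the squares.\<close>

lemma brownian_increment_times_past:
  assumes fil: "filtered_prob_space M T G" and W: "brownian_motion M T G W"
    and st: "0 \<le> s" "s \<le> t" "t \<le> T" and \<xi>: "\<xi> \<in> borel_measurable (G s)"
    and int: "integrable M \<xi>"
  shows "integrable M (\<lambda>\<omega>. \<xi> \<omega> * (W t \<omega> - W s \<omega>))" (is ?A)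
    and "(\<integral>\<omega>. \<xi> \<omega> * (W t \<omega> - W s \<omega>) \<partial>M) = 0" (is ?B)
    and "integrable M (\<lambda>\<omega>. \<xi> \<omega> * (W t \<omega> - W s \<omega>)\<^sup>2)" (is ?C)
    and "(\<integral>\<omega>. \<xi> \<omega> * (W t \<omega> - W s \<omega>)\<^sup>2 \<partial>M) = (\<integral>\<omega>. \<xi> \<omega> \<partial>M) * (t - s)" (is ?D)
proof -
  interpret prob_space M using fil unfolding filtered_prob_space_def by blast
  have "?A \<and> ?B \<and> ?C \<and> ?D"
  proof (cases "s = t")
    case False
    note m = brownian_increment_moments[OF fil W st]
    have i: "indep_var borel \<xi> borel (\<lambda>\<omega>. W t \<omega> - W s \<omega>)"
      using indep_brownian_increment[OF fil W _ _ _ \<xi>] st False by auto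
    have "indep_var borel ((\<lambda>x. x) \<circ> \<xi>) borel ((\<lambda>x. x\<^sup>2) \<circ> (\<lambda>\<omega>. W t \<omega> - W s \<omega>))"
      by (rule indep_var_compose[OF i]) auto
    then have i2: "indep_var borel \<xi> borel (\<lambda>\<omega>. (W t \<omega> - W s \<omega>)\<^sup>2)" by (simp add: comp_def)
    show ?thesis
      using indep_var_integrable[OF i int m(1)] indep_var_integrable[OF i2 int m(3)]
        indep_var_lebesgue_integral[OF i int m(1)] indep_var_lebesgue_integral[OF i2 int m(3)] m(2,4)
      by simp
  qed simp
  then show ?A ?B ?C ?D by auto
qed

section \<open>The Ito isometry for simple integrands\<close>

lemma simple_integral_Suc:
  "simple_integral W (Suc n) \<tau> \<xi> t \<omega> = simple_integral W n \<tau> \<xi> t \<omega> +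
     \<xi> n \<omega> * (W (min t (\<tau> (Suc n))) \<omega> - W (min t (\<tau> n)) \<omega>)"
  unfolding simple_integral_def by simp

text \<open>This is the integral of the squared simple process over \<open>[0,t]\<close>. The sum
  form shows that the first \<open>Suc i\<close> terms involve only \<open>\<xi> 0\<close> to
  \<open>\<xi> i\<close> and deterministic times, which makes stopping adapted.\<close>

definition simple_energy ::
  "nat \<Rightarrow> (nat \<Rightarrow> real) \<Rightarrow> (nat \<Rightarrow> 'a \<Rightarrow> real) \<Rightarrow> real \<Rightarrow> 'a \<Rightarrow> real" where
  "simple_energy n \<tau> \<xi> t \<omega> = (\<Sum>i<n. (\<xi> i \<omega>)\<^sup>2 * (min t (\<tau> (Suc i)) - min t (\<tau> i)))"

lemma simple_energy_Suc:
  "simple_energy (Suc n) \<tau> \<xi> t \<omega> = simple_energy n \<tau> \<xi> t \<omega> +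
     (\<xi> n \<omega>)\<^sup>2 * (min t (\<tau> (Suc n)) - min t (\<tau> n))"
  unfolding simple_energy_def by simp

lemma simple_integrand_Suc:
  assumes "simple_integrand M T F (Suc n) \<tau> \<xi>"
  shows "simple_integrand M T F n \<tau> \<xi>"
  using assms unfolding simple_integrand_def
  by (auto simp: image_subset_iff less_Suc_eq elim!: monotone_on_subset)

lemma borel_measurable_mono_filtration:
  assumes fil: "filtered_prob_space M T G" and st: "0 \<le> s" "s \<le> t" "t \<le> T"
    and f: "f \<in> borel_measurable (G s)"
  shows "f \<in> borel_measurable (G t)"
proof (rule measurable_from_subalg[OF _ f])
  show "subalgebra (G t) (G s)"
    using fil st unfolding filtered_prob_space_def subalgebra_def by auto
qed

text \<open>A new summand adds a cross term, killed because the increment is centred and independent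
  of the past, and a square, whose increment contributes its length. Measurability at
  \<open>\<tau> n\<close> travels through the induction because the partial sum has to belong to
  that past.\<close>

lemma simple_integral_isometry:
  assumes fil: "filtered_prob_space M T G" and W: "brownian_motion M T G W"
    and t: "t \<in> {0..T}" and \<xi>: "simple_integrand M T G n \<tau> \<xi>"
  shows "simple_integral W n \<tau> \<xi> t \<in> borel_measurable (G (\<tau> n)) \<and>
    integrable M (\<lambda>\<omega>. (simple_integral W n \<tau> \<xi> t \<omega>)\<^sup>2) \<and>
    integrable M (simple_energy n \<tau> \<xi> t) \<and>
    (\<integral>\<omega>. (simple_integral W n \<tau> \<xi> t \<omega>)\<^sup>2 \<partial>M) = (\<integral>\<omega>. simple_energy n \<tau> \<xi> t \<omega> \<partial>M)"
  using \<xi>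
proof (induction n)
  case 0
  show ?case unfolding simple_integral_def simple_energy_def by simp
next
  case (Suc n)
  interpret prob_space M using fil unfolding filtered_prob_space_def by blast
  let ?P = "simple_integral W n \<tau> \<xi> t"
  define s where "s = min t (\<tau> n)"
  define u where "u = min t (\<tau> (Suc n))"
  have \<tau>: "\<tau> n \<in> {0..T}" "\<tau> (Suc n) \<in> {0..T}" "\<tau> n \<le> \<tau> (Suc n)"
    and \<xi>n: "\<xi> n \<in> borel_measurable (G (\<tau> n))" and bd: "bounded (\<xi> n ` space M)"
    using Suc.prems unfolding simple_integrand_def by (auto simp: image_subset_iff monotone_on_def)
  have su: "0 \<le> s" "s \<le> u" "u \<le> T" "s \<le> \<tau> n" "u \<le> \<tau> (Suc n)"
    using \<tau> t by (auto simp: s_def u_def)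
  from bd obtain B where B: "\<And>\<omega>. \<omega> \<in> space M \<Longrightarrow> \<bar>\<xi> n \<omega>\<bar> \<le> B" unfolding bounded_iff by auto
  have sub: "subalgebra M (G u)" if "u \<in> {0..T}" for u
    using fil that unfolding filtered_prob_space_def by blast
  note IH = Suc.IH[OF simple_integrand_Suc[OF Suc.prems]]
  have Wm: "W v \<in> borel_measurable (G (\<tau> (Suc n)))" if "0 \<le> v" "v \<le> \<tau> (Suc n)" for v
    using W borel_measurable_mono_filtration[OF fil that, of "W v"] \<tau> that
    unfolding brownian_motion_def adapted_on_def by auto
  have \<xi>n': "\<xi> n \<in> borel_measurable (G (\<tau> (Suc n)))" and P': "?P \<in> borel_measurable (G (\<tau> (Suc n)))"
    using \<tau> \<xi>n IH by (auto intro: borel_measurable_mono_filtration[OF fil])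
  have m: "simple_integral W (Suc n) \<tau> \<xi> t \<in> borel_measurable (G (\<tau> (Suc n)))"
    using \<xi>n' P' Wm[of s] Wm[of u] su unfolding simple_integral_Suc[abs_def] s_def u_def by auto
  have \<xi>M[measurable]: "\<xi> n \<in> borel_measurable M" using measurable_from_subalg[OF sub \<xi>n] \<tau> by auto
  have PM[measurable]: "?P \<in> borel_measurable M"
    using measurable_from_subalg[OF sub] IH \<tau> by blast
  have iP: "integrable M ?P" using square_integrable_imp_integrable[OF PM] IH by blast
  \<comment> \<open>The partial sum is only square integrable; its product with the coefficient is
    integrable because the coefficient is bounded by \<open>B\<close>.\<close>
  have iP\<xi>: "integrable M (\<lambda>\<omega>. ?P \<omega> * \<xi> n \<omega>)"
  proof (rule Bochner_Integration.integrable_bound)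
    show "integrable M (\<lambda>\<omega>. B * ?P \<omega>)" using iP by simp
    show "AE \<omega> in M. norm (?P \<omega> * \<xi> n \<omega>) \<le> norm (B * ?P \<omega>)"
    proof (rule AE_I2)
      fix \<omega> assume "\<omega> \<in> space M"
      then have "\<bar>\<xi> n \<omega>\<bar> \<le> \<bar>B\<bar>" using B by fastforce
      then have "\<bar>\<xi> n \<omega>\<bar> * \<bar>?P \<omega>\<bar> \<le> \<bar>B\<bar> * \<bar>?P \<omega>\<bar>" by (rule mult_right_mono) simp
      then show "norm (?P \<omega> * \<xi> n \<omega>) \<le> norm (B * ?P \<omega>)" by (simp add: abs_mult mult.commute)
    qed
  qed measurable
  have i\<xi>2: "integrable M (\<lambda>\<omega>. (\<xi> n \<omega>)\<^sup>2)"
  proof (rule integrable_const_bound)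
    show "AE \<omega> in M. norm ((\<xi> n \<omega>)\<^sup>2) \<le> B\<^sup>2"
      using B by (intro AE_I2) (simp add: abs_le_square_iff[symmetric] order_trans[OF _ abs_ge_self])
  qed measurable
  let ?D = "\<lambda>\<omega>. W u \<omega> - W s \<omega>"
  have cross: "integrable M (\<lambda>\<omega>. (?P \<omega> * \<xi> n \<omega>) * ?D \<omega>) \<and> (\<integral>\<omega>. (?P \<omega> * \<xi> n \<omega>) * ?D \<omega> \<partial>M) = 0 \<and>
     integrable M (\<lambda>\<omega>. (\<xi> n \<omega>)\<^sup>2 * (?D \<omega>)\<^sup>2) \<and>
     (\<integral>\<omega>. (\<xi> n \<omega>)\<^sup>2 * (?D \<omega>)\<^sup>2 \<partial>M) = (\<integral>\<omega>. (\<xi> n \<omega>)\<^sup>2 \<partial>M) * (u - s)"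
  \<comment> \<open>For \<open>t < \<tau> n\<close> the coefficient need not be known at time
    \<open>s\<close>, but then both truncated end points equal \<open>t\<close> and the increment is
    0.\<close>
  proof (cases "\<tau> n \<le> t")
    case True
    then have s: "s = \<tau> n" by (simp add: s_def)
    have p1: "(\<lambda>\<omega>. ?P \<omega> * \<xi> n \<omega>) \<in> borel_measurable (G s)"
      and p2: "(\<lambda>\<omega>. (\<xi> n \<omega>)\<^sup>2) \<in> borel_measurable (G s)"
      using IH \<xi>n unfolding s by auto
    show ?thesis
      using brownian_increment_times_past[OF fil W su(1-3) p1 iP\<xi>]
        brownian_increment_times_past[OF fil W su(1-3) p2 i\<xi>2] by simp
  next
    case False
    then have "s = u" using \<tau> by (simp add: s_def u_def)
    then show ?thesis by simp
  qed
  have sq: "(simple_integral W (Suc n) \<tau> \<xi> t \<omega>)\<^sup>2 =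
      (?P \<omega>)\<^sup>2 + 2 * (?P \<omega> * \<xi> n \<omega> * ?D \<omega>) + (\<xi> n \<omega>)\<^sup>2 * (?D \<omega>)\<^sup>2" for \<omega>
    unfolding simple_integral_Suc s_def u_def by (simp add: power2_eq_square algebra_simps)
  have en: "simple_energy (Suc n) \<tau> \<xi> t \<omega> = simple_energy n \<tau> \<xi> t \<omega> + (\<xi> n \<omega>)\<^sup>2 * (u - s)" for \<omega>
    unfolding simple_energy_Suc s_def u_def by simp
  show ?case unfolding sq en[abs_def] using m IH cross i\<xi>2 by simp
qed

text \<open>Stopping the integrand when its energy would exceed \<open>c\<close> keeps it adapted, because
  the energy up to \<open>\<tau> (Suc i)\<close> is already known at \<open>\<tau> i\<close>.\<close>

definition stop_integrand ::
  "(nat \<Rightarrow> real) \<Rightarrow> (nat \<Rightarrow> 'a \<Rightarrow> real) \<Rightarrow> real \<Rightarrow> real \<Rightarrow> nat \<Rightarrow> 'a \<Rightarrow> real" where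
  "stop_integrand \<tau> \<xi> t c i \<omega> = (if simple_energy (Suc i) \<tau> \<xi> t \<omega> \<le> c then \<xi> i \<omega> else 0)"

lemma simple_energy_mono:
  assumes "mono_on {..n} \<tau>" "m \<le> n"
  shows "simple_energy m \<tau> \<xi> t \<omega> \<le> simple_energy n \<tau> \<xi> t \<omega>"
  unfolding simple_energy_def
proof (rule sum_mono2)
  fix i assume "i \<in> {..<n} - {..<m}"
  then have "\<tau> i \<le> \<tau> (Suc i)" using assms by (auto simp: monotone_on_def)
  then show "0 \<le> (\<xi> i \<omega>)\<^sup>2 * (min t (\<tau> (Suc i)) - min t (\<tau> i))"
    by (intro mult_nonneg_nonneg) auto
qed (use assms in auto)

text \<open>The minimum carries the induction: when a term is kept, the bound by \<open>c\<close>
  follows from comparison with the unstopped energy, which passed the test; when it is dropped, the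
  earlier bound persists.\<close>

lemma simple_energy_stop_integrand:
  assumes "mono_on {..n} \<tau>" "c \<ge> 0"
  shows "simple_energy n \<tau> (stop_integrand \<tau> \<xi> t c) t \<omega> \<le> min c (simple_energy n \<tau> \<xi> t \<omega>)"
  using assms(1)
proof (induction n)
  case 0
  then show ?case using assms(2) by (simp add: simple_energy_def)
next
  case (Suc n)
  have "mono_on {..n} \<tau>" using Suc.prems by (rule monotone_on_subset) auto
  note IH = Suc.IH[OF this]
  have "simple_energy n \<tau> \<xi> t \<omega> \<le> simple_energy (Suc n) \<tau> \<xi> t \<omega>"
    by (rule simple_energy_mono[OF Suc.prems]) simp
  then show ?case using IH
    by (auto simp: simple_energy_Suc[of n \<tau> "stop_integrand \<tau> \<xi> t c"] stop_integrand_def)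
      (auto simp: simple_energy_Suc)
qed

lemma simple_integral_stop_integrand:
  assumes mono: "mono_on {..n} \<tau>" and c: "simple_energy n \<tau> \<xi> t \<omega> \<le> c"
  shows "simple_integral W n \<tau> (stop_integrand \<tau> \<xi> t c) t \<omega> = simple_integral W n \<tau> \<xi> t \<omega>"
  unfolding simple_integral_def
proof (rule sum.cong[OF refl])
  fix i assume "i \<in> {..<n}"
  then have "simple_energy (Suc i) \<tau> \<xi> t \<omega> \<le> c"
    using simple_energy_mono[OF mono, of "Suc i" \<xi> t \<omega>] c by auto
  then show "stop_integrand \<tau> \<xi> t c i \<omega> * (W (min t (\<tau> (Suc i))) \<omega> - W (min t (\<tau> i)) \<omega>) =
      \<xi> i \<omega> * (W (min t (\<tau> (Suc i))) \<omega> - W (min t (\<tau> i)) \<omega>)"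
    by (simp add: stop_integrand_def)
qed

lemma simple_integrand_stop_integrand:
  assumes fil: "filtered_prob_space M T G" and \<xi>: "simple_integrand M T G n \<tau> \<xi>"
  shows "simple_integrand M T G n \<tau> (stop_integrand \<tau> \<xi> t c)"
  unfolding simple_integrand_def
proof (intro conjI allI impI)
  show \<tau>: "\<tau> ` {..n} \<subseteq> {0..T}" and mono: "mono_on {..n} \<tau>"
    using \<xi> unfolding simple_integrand_def by auto
  fix i assume i: "i < n"
  have [measurable]: "\<xi> j \<in> borel_measurable (G (\<tau> i))" if "j < Suc i" for j
  proof (rule borel_measurable_mono_filtration[OF fil])
    show "0 \<le> \<tau> j" "\<tau> i \<le> T" using \<tau> i that by (auto simp: image_subset_iff)
    show "\<tau> j \<le> \<tau> i" using mono i that by (auto simp: monotone_on_def)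
    show "\<xi> j \<in> borel_measurable (G (\<tau> j))" using \<xi> i that unfolding simple_integrand_def by auto
  qed
  have [measurable]: "simple_energy (Suc i) \<tau> \<xi> t \<in> borel_measurable (G (\<tau> i))"
    unfolding simple_energy_def[abs_def] by (intro borel_measurable_sum) auto
  have "\<xi> i \<in> borel_measurable (G (\<tau> i))" by simp
  then show "stop_integrand \<tau> \<xi> t c i \<in> borel_measurable (G (\<tau> i))"
    unfolding stop_integrand_def[abs_def] by measurable
  obtain B where "\<forall>\<omega>\<in>space M. \<bar>\<xi> i \<omega>\<bar> \<le> B"
    using \<xi> i unfolding simple_integrand_def bounded_iff by auto
  then have "\<forall>\<omega>\<in>space M. \<bar>stop_integrand \<tau> \<xi> t c i \<omega>\<bar> \<le> \<bar>B\<bar>"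
    unfolding stop_integrand_def by force
  then show "bounded (stop_integrand \<tau> \<xi> t c i ` space M)"
    unfolding bounded_iff by auto
qed

text \<open>Unless the energy exceeds \<open>c\<close>, stopping changes nothing. The stopped
  integral has second moment at most \<open>c\<close> by the isometry, and Chebyshev's inequality
  gives the last term.\<close>

lemma simple_integral_tail_bound:
  assumes fil: "filtered_prob_space M T G" and W: "brownian_motion M T G W"
    and t: "t \<in> {0..T}" and \<xi>: "simple_integrand M T G n \<tau> \<xi>" and c: "c \<ge> 0" and \<eta>: "\<eta> > 0"
  shows "measure M {\<omega>\<in>space M. \<bar>simple_integral W n \<tau> \<xi> t \<omega>\<bar> > \<eta>} \<le>
    measure M {\<omega>\<in>space M. simple_energy n \<tau> \<xi> t \<omega> > c} + c / \<eta>\<^sup>2"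
proof -
  interpret prob_space M using fil unfolding filtered_prob_space_def by blast
  let ?\<xi> = "stop_integrand \<tau> \<xi> t c"
  let ?S = "simple_integral W n \<tau> ?\<xi> t"
  have mono: "mono_on {..n} \<tau>" and \<tau>: "\<tau> n \<in> {0..T}"
    using \<xi> unfolding simple_integrand_def by (auto simp: image_subset_iff)
  note iso = simple_integral_isometry[OF fil W t simple_integrand_stop_integrand[OF fil \<xi>, of t c]]
  have SM[measurable]: "?S \<in> borel_measurable M"
    using iso measurable_from_subalg \<tau> fil unfolding filtered_prob_space_def by blast
  have [measurable]: "simple_energy n \<tau> \<xi> t \<in> borel_measurable M"
    using simple_integral_isometry[OF fil W t \<xi>] by auto
  have "measure M {\<omega>\<in>space M. \<bar>simple_integral W n \<tau> \<xi> t \<omega>\<bar> > \<eta>} \<le>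
      measure M ({\<omega>\<in>space M. simple_energy n \<tau> \<xi> t \<omega> > c} \<union> {\<omega>\<in>space M. \<eta> \<le> \<bar>?S \<omega>\<bar>})"
  proof (rule finite_measure_mono)
    show "{\<omega>\<in>space M. \<bar>simple_integral W n \<tau> \<xi> t \<omega>\<bar> > \<eta>} \<subseteq>
        {\<omega>\<in>space M. simple_energy n \<tau> \<xi> t \<omega> > c} \<union> {\<omega>\<in>space M. \<eta> \<le> \<bar>?S \<omega>\<bar>}"
    proof (intro subsetI)
      fix \<omega> assume "\<omega> \<in> {\<omega>\<in>space M. \<bar>simple_integral W n \<tau> \<xi> t \<omega>\<bar> > \<eta>}"
      then show "\<omega> \<in> {\<omega>\<in>space M. simple_energy n \<tau> \<xi> t \<omega> > c} \<union> {\<omega>\<in>space M. \<eta> \<le> \<bar>?S \<omega>\<bar>}"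
        using simple_integral_stop_integrand[OF mono, of \<xi> t \<omega> c W]
        by (cases "simple_energy n \<tau> \<xi> t \<omega> \<le> c") auto
    qed
  qed measurable
  also have "\<dots> \<le> measure M {\<omega>\<in>space M. simple_energy n \<tau> \<xi> t \<omega> > c} +
      measure M {\<omega>\<in>space M. \<eta> \<le> \<bar>?S \<omega>\<bar>}"
    by (rule measure_Un_le) measurable
  also have "measure M {\<omega>\<in>space M. \<eta> \<le> \<bar>?S \<omega>\<bar>} \<le> (\<integral>\<omega>. (?S \<omega>)\<^sup>2 \<partial>M) / \<eta>\<^sup>2"
    using second_moment_method[of ?S \<eta>] iso \<eta> by simp
  also have "(\<integral>\<omega>. (?S \<omega>)\<^sup>2 \<partial>M) = (\<integral>\<omega>. simple_energy n \<tau> ?\<xi> t \<omega> \<partial>M)" using iso by blast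
  also have "\<dots> \<le> (\<integral>\<omega>. c \<partial>M)"
    by (rule integral_mono) (use iso simple_energy_stop_integrand[OF mono c, of \<xi> t] in auto)
  also have "\<dots> = c" by (simp add: prob_space)
  finally show ?thesis using \<eta> by (simp add: divide_right_mono)
qed

section \<open>Ito integrals of integrands vanishing on an initial interval\<close>

text \<open>The half-open intervals are disjoint, so the square has no cross terms: to the right of
  \<open>\<tau> n\<close> all earlier summands vanish.\<close>

lemma simple_process_square:
  assumes "mono_on {..n} \<tau>"
  shows "(simple_process n \<tau> \<xi> s \<omega>)\<^sup>2 = (\<Sum>i<n. (\<xi> i \<omega>)\<^sup>2 * indicator {\<tau> i<..\<tau> (Suc i)} s)"
  using assms
proof (induction n)
  case 0
  then show ?case by (simp add: simple_process_def)
next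
  case (Suc n)
  have "mono_on {..n} \<tau>" using Suc.prems by (rule monotone_on_subset) auto
  note IH = Suc.IH[OF this]
  have step: "simple_process (Suc n) \<tau> \<xi> s \<omega> =
      simple_process n \<tau> \<xi> s \<omega> + \<xi> n \<omega> * indicator {\<tau> n<..\<tau> (Suc n)} s"
    by (simp add: simple_process_def)
  have "simple_process n \<tau> \<xi> s \<omega> = 0" if "\<tau> n < s"
    unfolding simple_process_def
  proof (rule sum.neutral, rule ballI)
    fix i assume "i \<in> {..<n}"
    then have "\<tau> (Suc i) \<le> \<tau> n" using Suc.prems by (auto simp: monotone_on_def)
    then show "\<xi> i \<omega> * indicator {\<tau> i<..\<tau> (Suc i)} s = 0" using that by simp
  qed
  then show ?case
    using IH unfolding step by (cases "\<tau> n < s") (auto simp: power_mult_distrib indicator_def)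
qed

lemma simple_process_energy:
  assumes mono: "mono_on {..n} \<tau>" and \<tau>: "\<tau> ` {..n} \<subseteq> {0..T}" and t: "0 \<le> t"
  shows "set_integrable lborel {0..t} (\<lambda>s. (simple_process n \<tau> \<xi> s \<omega>)\<^sup>2)"
    and "(LINT s:{0..t}|lborel. (simple_process n \<tau> \<xi> s \<omega>)\<^sup>2) = simple_energy n \<tau> \<xi> t \<omega>"
proof -
  \<comment> \<open>Since \<open>\<tau> i\<close> is nonnegative, cutting an interval at
    \<open>t\<close> amounts to truncating both its end points; beyond \<open>t\<close> it becomes
    empty.\<close>
  have eq: "indicator {0..t} s *\<^sub>R (simple_process n \<tau> \<xi> s \<omega>)\<^sup>2 =
      (\<Sum>i<n. (\<xi> i \<omega>)\<^sup>2 * indicator {min t (\<tau> i)<..min t (\<tau> (Suc i))} s)" for s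
  proof -
    have "indicator {0..t} s *\<^sub>R (simple_process n \<tau> \<xi> s \<omega>)\<^sup>2 =
        (\<Sum>i<n. (\<xi> i \<omega>)\<^sup>2 * (indicator {0..t} s * indicator {\<tau> i<..\<tau> (Suc i)} s))"
      unfolding simple_process_square[OF mono] real_scaleR_def sum_distrib_left
      by (intro sum.cong refl mult.left_commute)
    also have "\<dots> = (\<Sum>i<n. (\<xi> i \<omega>)\<^sup>2 * indicator {min t (\<tau> i)<..min t (\<tau> (Suc i))} s)"
    proof (rule sum.cong[OF refl])
      fix i assume "i \<in> {..<n}"
      then have "0 \<le> \<tau> i" using \<tau> by (auto simp: image_subset_iff)
      then show "(\<xi> i \<omega>)\<^sup>2 * (indicator {0..t} s * indicator {\<tau> i<..\<tau> (Suc i)} s) =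
          (\<xi> i \<omega>)\<^sup>2 * indicator {min t (\<tau> i)<..min t (\<tau> (Suc i))} s"
        by (auto simp: indicator_def)
    qed
    finally show ?thesis .
  qed
  have le: "min t (\<tau> i) \<le> min t (\<tau> (Suc i))" if "i < n" for i
  proof -
    have "\<tau> i \<le> \<tau> (Suc i)" using mono that by (auto simp: monotone_on_def)
    then show ?thesis by auto
  qed
  have "has_bochner_integral lborel (\<lambda>s. (\<xi> i \<omega>)\<^sup>2 * indicator {min t (\<tau> i)<..min t (\<tau> (Suc i))} s)
      ((\<xi> i \<omega>)\<^sup>2 * (min t (\<tau> (Suc i)) - min t (\<tau> i)))" if "i < n" for i
  proof (rule has_bochner_integral_mult_right)
    show "has_bochner_integral lborel (indicat_real {min t (\<tau> i)<..min t (\<tau> (Suc i))})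
        (min t (\<tau> (Suc i)) - min t (\<tau> i))"
      using has_bochner_integral_real_indicator[of "{min t (\<tau> i)<..min t (\<tau> (Suc i))}" lborel] le[OF that]
      by simp
  qed
  then have "has_bochner_integral lborel
      (\<lambda>s. \<Sum>i<n. (\<xi> i \<omega>)\<^sup>2 * indicator {min t (\<tau> i)<..min t (\<tau> (Suc i))} s) (simple_energy n \<tau> \<xi> t \<omega>)"
    unfolding simple_energy_def by (intro has_bochner_integral_sum) auto
  then have "has_bochner_integral lborel
      (\<lambda>s. indicator {0..t} s *\<^sub>R (simple_process n \<tau> \<xi> s \<omega>)\<^sup>2) (simple_energy n \<tau> \<xi> t \<omega>)"
    unfolding eq .
  then show "set_integrable lborel {0..t} (\<lambda>s. (simple_process n \<tau> \<xi> s \<omega>)\<^sup>2)"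
    and "(LINT s:{0..t}|lborel. (simple_process n \<tau> \<xi> s \<omega>)\<^sup>2) = simple_energy n \<tau> \<xi> t \<omega>"
    unfolding set_integrable_def set_lebesgue_integral_def
    by (auto simp: has_bochner_integral_iff)
qed

text \<open>Integrability of the squared path does not make the path itself measurable; the mixed
  term in \<open>(S - H)\<^sup>2\<close> requires that, and progressive measurability at time
  \<open>T\<close> supplies it.\<close>

lemma progressive_on_section:
  assumes H: "progressive_on T G H" and T: "0 \<le> T" and \<omega>: "\<omega> \<in> space (G T)"
  shows "(\<lambda>s. indicator {0..T} s *\<^sub>R H s \<omega>) \<in> borel_measurable borel"
proof -
  have "(\<lambda>(s, \<omega>). H s \<omega>) \<in> borel_measurable (restrict_space borel {0..T} \<Otimes>\<^sub>M G T)"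
    using H T unfolding progressive_on_def by auto
  from measurable_compose[OF measurable_Pair2'[OF \<omega>] this]
  have "(\<lambda>s. H s \<omega>) \<in> borel_measurable (restrict_space borel {0..T})" by simp
  then show ?thesis by (subst (asm) borel_measurable_restrict_space_iff) auto
qed

text \<open>Where \<open>h\<close> vanishes, the squared distance to \<open>h\<close> is the square
  of the simple process, and the remaining times only add nonnegative mass.\<close>

lemma simple_energy_le_distance:
  assumes mono: "mono_on {..n} \<tau>" and \<tau>: "\<tau> ` {..n} \<subseteq> {0..T}" and t: "t \<in> {0..\<delta>}" and \<delta>: "\<delta> \<le> T"
    and hm: "(\<lambda>s. indicator {0..T} s *\<^sub>R h s) \<in> borel_measurable borel"
    and h: "set_integrable lborel {0..T} (\<lambda>s. (h s)\<^sup>2)"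
    and h0: "AE s in lborel. s \<in> {0..\<delta>} \<longrightarrow> h s = 0"
  shows "simple_energy n \<tau> \<xi> t \<omega> \<le> (LINT s:{0..T}|lborel. (simple_process n \<tau> \<xi> s \<omega> - h s)\<^sup>2)"
proof -
  let ?S = "\<lambda>s. simple_process n \<tau> \<xi> s \<omega>"
  have T: "0 \<le> T" "0 \<le> t" using t \<delta> by auto
  have [measurable]: "(\<lambda>s. indicator {0..T} s *\<^sub>R h s) \<in> borel_measurable borel" by fact
  have [measurable]: "?S \<in> borel_measurable borel" unfolding simple_process_def by measurable
  \<comment> \<open>This is essential: the integral of a nonintegrable function defaults to 0, which
    would not bound the energy.\<close>
  have int: "integrable lborel (\<lambda>s. indicator {0..T} s *\<^sub>R (?S s - h s)\<^sup>2)"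
  proof (rule Bochner_Integration.integrable_bound)
    show "integrable lborel (\<lambda>s. 2 * (indicator {0..T} s *\<^sub>R (?S s)\<^sup>2) + 2 * (indicator {0..T} s *\<^sub>R (h s)\<^sup>2))"
      using simple_process_energy(1)[OF mono \<tau> T(1)] h unfolding set_integrable_def
      by (intro Bochner_Integration.integrable_add integrable_mult_right)
    have "(\<lambda>s. indicator {0..T} s *\<^sub>R (?S s - indicator {0..T} s *\<^sub>R h s)\<^sup>2) \<in> borel_measurable lborel"
      by measurable
    also have "(\<lambda>s. indicator {0..T} s *\<^sub>R (?S s - indicator {0..T} s *\<^sub>R h s)\<^sup>2) =
        (\<lambda>s. indicator {0..T} s *\<^sub>R (?S s - h s)\<^sup>2)" by (auto simp: indicator_def)
    finally show "(\<lambda>s. indicator {0..T} s *\<^sub>R (?S s - h s)\<^sup>2) \<in> borel_measurable lborel" .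
    have "(?S s - h s)\<^sup>2 \<le> 2 * (?S s)\<^sup>2 + 2 * (h s)\<^sup>2" for s
      using zero_le_power2[of "?S s + h s"] by (simp add: power2_eq_square algebra_simps)
    then show "AE s in lborel. norm (indicator {0..T} s *\<^sub>R (?S s - h s)\<^sup>2) \<le>
        norm (2 * (indicator {0..T} s *\<^sub>R (?S s)\<^sup>2) + 2 * (indicator {0..T} s *\<^sub>R (h s)\<^sup>2))"
      by (intro AE_I2) (auto simp: indicator_def abs_of_nonneg add_nonneg_nonneg)
  qed
  have "simple_energy n \<tau> \<xi> t \<omega> = (LINT s:{0..t}|lborel. (?S s)\<^sup>2)"
    by (rule simple_process_energy(2)[OF mono \<tau> T(2), symmetric])
  also have "\<dots> \<le> (LINT s:{0..T}|lborel. (?S s - h s)\<^sup>2)"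
    unfolding set_lebesgue_integral_def
  proof (rule integral_mono_AE)
    show "integrable lborel (\<lambda>s. indicator {0..t} s *\<^sub>R (?S s)\<^sup>2)"
      using simple_process_energy(1)[OF mono \<tau> T(2)] unfolding set_integrable_def .
    show "AE s in lborel. indicator {0..t} s *\<^sub>R (?S s)\<^sup>2 \<le> indicator {0..T} s *\<^sub>R (?S s - h s)\<^sup>2"
      using h0
    proof eventually_elim
      case (elim s)
      show ?case
      proof (cases "s \<in> {0..t}")
        case True
        then have "h s = 0" "s \<in> {0..T}" using elim t \<delta> by auto
        then show ?thesis by (simp add: indicator_def)
      qed simp
    qed
  qed (rule int)
  finally show ?thesis .
qed

text \<open>The energies up to \<open>t\<close> tend to 0 in probability, being dominated by the
  approximation error \<open>D k\<close>, and the tail bound passes this on to the simple integrals.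
  The null set of times in \<open>H0\<close> is common to all paths, so it can be used for each path
  separately.\<close>

lemma ito_integral_zero:
  assumes fil: "filtered_prob_space M T G" and W: "brownian_motion M T G W"
    and I: "is_ito_integral M T G W H I" and \<delta>: "0 \<le> \<delta>" "\<delta> \<le> T"
    and H0: "AE s in lborel. s \<in> {0..\<delta>} \<longrightarrow> (\<forall>\<omega>. H s \<omega> = 0)"
  shows "AE \<omega> in M. \<forall>t\<in>{0..\<delta>}. I t \<omega> = 0"
proof (rule AE_cadlag_zero)
  interpret prob_space M using fil unfolding filtered_prob_space_def by blast
  show "cadlag_on T (\<lambda>t. I t \<omega>)" if "\<omega> \<in> space M" for \<omega>
    using I that unfolding is_ito_integral_def by (intro continuous_on_imp_cadlag_on) blast
  fix t assume t: "t \<in> {0..\<delta>}"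
  then have tT: "t \<in> {0..T}" using \<delta> by auto
  have "\<exists>n \<tau> \<xi>.
        (\<forall>k::nat. simple_integrand M T G (n k) (\<tau> k) (\<xi> k)) \<and>
        tendsto_in_prob M
          (\<lambda>k \<omega>. LINT s:{0..T}|lborel. (simple_process (n k) (\<tau> k) (\<xi> k) s \<omega> - H s \<omega>)\<^sup>2)
          (\<lambda>_. 0) sequentially \<and>
        (\<forall>t\<in>{0..T}. tendsto_in_prob M (\<lambda>k. simple_integral W (n k) (\<tau> k) (\<xi> k) t) (I t) sequentially)"
    using I unfolding is_ito_integral_def by blast
  then obtain n \<tau> \<xi> where si: "\<And>k::nat. simple_integrand M T G (n k) (\<tau> k) (\<xi> k)"
    and conv: "tendsto_in_prob M
          (\<lambda>k \<omega>. LINT s:{0..T}|lborel. (simple_process (n k) (\<tau> k) (\<xi> k) s \<omega> - H s \<omega>)\<^sup>2)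
          (\<lambda>_. 0) sequentially"
    and lim: "\<forall>t\<in>{0..T}. tendsto_in_prob M (\<lambda>k. simple_integral W (n k) (\<tau> k) (\<xi> k) t) (I t) sequentially"
    by blast
  let ?S = "\<lambda>k. simple_integral W (n k) (\<tau> k) (\<xi> k) t"
  define D where "D k \<omega> = (LINT s:{0..T}|lborel. (simple_process (n k) (\<tau> k) (\<xi> k) s \<omega> - H s \<omega>)\<^sup>2)" for k \<omega>
  have prog: "progressive_on T G H"
    and H2: "AE \<omega> in M. set_integrable lborel {0..T} (\<lambda>s. (H s \<omega>)\<^sup>2)"
    using I unfolding is_ito_integral_def by blast+
  have spG: "space (G T) = space M"
    using fil \<delta> unfolding filtered_prob_space_def subalgebra_def by auto
  have D: "tendsto_in_prob M D (\<lambda>_. 0) sequentially" using conv unfolding D_def[abs_def] .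
  have le: "AE \<omega> in M. simple_energy (n k) (\<tau> k) (\<xi> k) t \<omega> \<le> D k \<omega>" for k
    using H2
  proof (rule AE_mp, intro AE_I2 impI)
    fix \<omega> assume \<omega>: "\<omega> \<in> space M" and h: "set_integrable lborel {0..T} (\<lambda>s. (H s \<omega>)\<^sup>2)"
    show "simple_energy (n k) (\<tau> k) (\<xi> k) t \<omega> \<le> D k \<omega>"
      unfolding D_def
    proof (rule simple_energy_le_distance[OF _ _ t \<delta>(2) _ h])
      show "(\<lambda>s. indicator {0..T} s *\<^sub>R H s \<omega>) \<in> borel_measurable borel"
        by (rule progressive_on_section[OF prog]) (use \<omega> spG \<delta> in auto)
      show "AE s in lborel. s \<in> {0..\<delta>} \<longrightarrow> H s \<omega> = 0" using H0 by eventually_elim auto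
    qed (use si[of k] in \<open>auto simp: simple_integrand_def\<close>)
  qed
  show "AE \<omega> in M. I t \<omega> = 0"
  proof (rule tendsto_in_prob_limit_zero[where Z = ?S and G = sequentially])
    show "tendsto_in_prob M ?S (I t) sequentially" using lim tT by blast
    fix \<eta> :: real assume \<eta>: "\<eta> > 0"
    show "((\<lambda>k. measure M {\<omega>\<in>space M. \<bar>?S k \<omega>\<bar> > \<eta>}) \<longlongrightarrow> 0) sequentially"
    proof (rule tendstoI)
      fix e :: real assume e: "e > 0"
      \<comment> \<open>This choice makes the Chebyshev term \<open>c / \<eta>\<^sup>2\<close> equal
        to \<open>e / 2\<close>; the other half is left for the probability that the energy exceeds
        \<open>c\<close>.\<close>
      define c where "c = e * \<eta>\<^sup>2 / 2"
      have c: "c > 0" "c / \<eta>\<^sup>2 = e / 2" using e \<eta> by (auto simp: c_def)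
      have "((\<lambda>k. measure M {\<omega>\<in>space M. \<bar>D k \<omega> - 0\<bar> > c}) \<longlongrightarrow> 0) sequentially"
        using D c unfolding tendsto_in_prob_def by blast
      then have ev: "\<forall>\<^sub>F k in sequentially. measure M {\<omega>\<in>space M. \<bar>D k \<omega> - 0\<bar> > c} < e / 2"
        by (rule order_tendstoD) (use e in simp)
      have "\<forall>\<^sub>F k in sequentially. D k \<in> borel_measurable M"
        using D unfolding tendsto_in_prob_def by blast
      with ev show "\<forall>\<^sub>F k in sequentially. dist (measure M {\<omega>\<in>space M. \<bar>?S k \<omega>\<bar> > \<eta>}) 0 < e"
      proof eventually_elim
        case (elim k)
        have [measurable]: "D k \<in> borel_measurable M" by fact
        have "measure M {\<omega>\<in>space M. simple_energy (n k) (\<tau> k) (\<xi> k) t \<omega> > c} \<le>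
            measure M {\<omega>\<in>space M. \<bar>D k \<omega> - 0\<bar> > c}"
        proof (rule finite_measure_mono_AE)
          show "AE \<omega> in M. \<omega> \<in> {\<omega>\<in>space M. simple_energy (n k) (\<tau> k) (\<xi> k) t \<omega> > c} \<longrightarrow>
              \<omega> \<in> {\<omega>\<in>space M. \<bar>D k \<omega> - 0\<bar> > c}"
            using le[of k] by eventually_elim auto
        qed measurable
        then show ?case
          using simple_integral_tail_bound[OF fil W tT si[of k] less_imp_le[OF c(1)] \<eta>] elim(1) c(2)
          by (simp add: dist_real_def)
      qed
    qed
  qed (auto intro: finite_measure_axioms)
qed (use \<delta> in auto)

section \<open>Levy integrals, and uniqueness for the drift equation\<close>

text \<open>Away from 0 the integrand \<open>min 1 (z\<^sup>2)\<close> is bounded below, so the sets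
  \<open>B n\<close> have finite mass; with the null set \<open>{0}\<close> they exhaust the line.
  Product measures with an infinite \<open>\<nu>\<close> rely on this.\<close>

lemma sigma_finite_levy_measure:
  assumes "levy_measure \<nu>"
  shows "sigma_finite_measure \<nu>"
proof
  have s: "sets \<nu> = sets borel" and z: "emeasure \<nu> {0} = 0"
    and fin: "(\<integral>\<^sup>+z. ennreal (min 1 (z\<^sup>2)) \<partial>\<nu>) < \<infinity>"
    using assms unfolding levy_measure_def by auto
  have sp: "space \<nu> = UNIV" using sets_eq_imp_space_eq[OF s] by simp
  define B where "B n = {z::real. 1 / real (Suc n) \<le> \<bar>z\<bar>}" for n
  have Bm: "B n \<in> sets \<nu>" for n
  proof -
    have "B n \<in> sets borel" unfolding B_def by measurable
    then show ?thesis using s by simp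
  qed
  have Bfin: "emeasure \<nu> (B n) \<noteq> \<infinity>" for n
  proof
    assume inf: "emeasure \<nu> (B n) = \<infinity>"
    have "(\<integral>\<^sup>+z. ennreal ((1 / real (Suc n))\<^sup>2) * indicator (B n) z \<partial>\<nu>) \<le> (\<integral>\<^sup>+z. ennreal (min 1 (z\<^sup>2)) \<partial>\<nu>)"
    proof (rule nn_integral_mono)
      fix z
      show "ennreal ((1 / real (Suc n))\<^sup>2) * indicator (B n) z \<le> ennreal (min 1 (z\<^sup>2))"
      proof (cases "z \<in> B n")
        case True
        then have "(1 / real (Suc n))\<^sup>2 \<le> \<bar>z\<bar>\<^sup>2" unfolding B_def by (intro power_mono) auto
        moreover have "(1 / real (Suc n))\<^sup>2 \<le> 1" by (rule power_le_one) auto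
        ultimately have "(1 / real (Suc n))\<^sup>2 \<le> min 1 (z\<^sup>2)" by simp
        then show ?thesis using True by (simp add: ennreal_leI)
      qed simp
    qed
    moreover have "(\<integral>\<^sup>+z. ennreal ((1 / real (Suc n))\<^sup>2) * indicator (B n) z \<partial>\<nu>) = \<infinity>"
      using Bm[of n] inf by (simp add: nn_integral_cmult_indicator ennreal_mult_top)
    ultimately show False using fin by (simp add: top_unique)
  qed
  show "\<exists>A. countable A \<and> A \<subseteq> sets \<nu> \<and> \<Union> A = space \<nu> \<and> (\<forall>a\<in>A. emeasure \<nu> a \<noteq> \<infinity>)"
  proof (intro exI conjI)
    show "countable (insert {0} (range B))" by simp
    show "insert {0} (range B) \<subseteq> sets \<nu>" using Bm s by auto
    have "z \<in> \<Union> (insert {0} (range B))" for z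
    proof (cases "z = 0")
      case False
      then obtain n where "1 / real (Suc n) < \<bar>z\<bar>" using nat_approx_posE[of "\<bar>z\<bar>"] by auto
      then have "z \<in> B n" unfolding B_def by simp
      then show ?thesis by blast
    qed simp
    then show "\<Union> (insert {0} (range B)) = space \<nu>" using sp by blast
    show "\<forall>a\<in>insert {0} (range B). emeasure \<nu> a \<noteq> \<infinity>" using z Bfin by auto
  qed
qed

lemma poisson_random_measure_null:
  assumes M: "prob_space M" and N: "poisson_random_measure M N \<mu>" and A: "A \<in> null_sets \<mu>"
  shows "AE \<omega> in M. A \<in> null_sets (N \<omega>)"
proof -
  interpret prob_space M by fact
  have sets: "\<forall>\<omega>\<in>space M. sets (N \<omega>) = sets \<mu>"
    and meas[measurable]: "(\<lambda>\<omega>. emeasure (N \<omega>) A) \<in> borel_measurable M"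
    using N A unfolding poisson_random_measure_def by auto
  have "\<forall>k::nat. measure M {\<omega>\<in>space M. emeasure (N \<omega>) A = of_nat k} =
      measure \<mu> A ^ k / fact k * exp (- measure \<mu> A)"
    using N A unfolding poisson_random_measure_def by (auto simp: null_sets_def)
  \<comment> \<open>For intensity 0 and \<open>k = 0\<close> the Poisson weight is
    \<open>0 ^ 0 * exp 0\<close>, which is 1.\<close>
  from spec[OF this, of 0] have "measure M {\<omega>\<in>space M. emeasure (N \<omega>) A = 0} = 1"
    using A by (simp add: measure_def[of \<mu>] null_setsD1)
  then have "AE \<omega> in M. \<omega> \<in> {\<omega>\<in>space M. emeasure (N \<omega>) A = 0}"
    by (subst AE_in_set_eq_1) measurable
  then show ?thesis
  proof (rule AE_mp, intro AE_I2 impI)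
    fix \<omega> assume "\<omega> \<in> space M" "\<omega> \<in> {\<omega>\<in>space M. emeasure (N \<omega>) A = 0}"
    then show "A \<in> null_sets (N \<omega>)" using sets A by (auto simp: null_sets_def)
  qed
qed

text \<open>The mass of the strip is 0 times the possibly infinite mass of \<open>\<nu>\<close>, and
  that product is 0 in \<open>ennreal\<close>.\<close>

lemma null_sets_times_UNIV:
  assumes "sigma_finite_measure \<nu>" and "sets \<nu> = sets borel" and E: "E \<in> null_sets Q"
  shows "E \<times> UNIV \<in> null_sets (Q \<Otimes>\<^sub>M (\<nu> :: real measure))"
proof -
  interpret sigma_finite_measure \<nu> by fact
  have U: "UNIV \<in> sets \<nu>" using assms(2) by simp
  have "emeasure (Q \<Otimes>\<^sub>M \<nu>) (E \<times> UNIV) = emeasure Q E * emeasure \<nu> UNIV"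
    using E U by (intro emeasure_pair_measure_Times) auto
  then show ?thesis using E U by (auto simp: null_sets_def)
qed

lemma set_integral_vanishing_integrand:
  fixes k :: "real \<Rightarrow> real"
  assumes Q: "E \<times> UNIV \<in> null_sets Q" and t: "t \<le> \<delta>" and E: "\<And>s. s \<in> {0<..\<delta>} \<Longrightarrow> s \<notin> E \<Longrightarrow> k s = 0"
  shows "(LINT p:({0<..t} \<times> B)|Q. k (fst p) * snd p) = 0"
  unfolding set_lebesgue_integral_def
proof (rule integral_eq_zero_AE)
  show "AE p in Q. indicator ({0<..t} \<times> B) p *\<^sub>R (k (fst p) * snd p) = 0"
    using AE_not_in[OF Q]
  proof eventually_elim
    case (elim p)
    then have "k (fst p) = 0" if "fst p \<in> {0<..t}"
      using that t by (intro E) (auto simp: mem_Times_iff)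
    then show ?case by (auto simp: indicator_def mem_Times_iff)
  qed
qed

lemma levy_integral_zero:
  assumes M: "prob_space M" and \<nu>: "levy_measure \<nu>"
    and N: "poisson_random_measure M (jump_measure T L) (density lborel (indicator {0..T}) \<Otimes>\<^sub>M \<nu>)"
    and Z: "is_levy_integral M T G \<nu> L k Z" and k: "set_borel_measurable borel {0..T} k"
    and \<delta>: "0 \<le> \<delta>" "\<delta> \<le> T" and k0: "AE t in lborel. t \<in> {0..\<delta>} \<longrightarrow> k t = 0"
  shows "AE \<omega> in M. \<forall>t\<in>{0..\<delta>}. Z t \<omega> = 0"
proof -
  interpret prob_space M by fact
  have sf: "sigma_finite_measure \<nu>" and sn: "sets \<nu> = sets borel"
    using sigma_finite_levy_measure[OF \<nu>] \<nu> unfolding levy_measure_def by auto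
  define E where "E = {s\<in>{0..\<delta>}. k s \<noteq> 0}"
  \<comment> \<open>Only the restriction of \<open>k\<close> to \<open>[0,T]\<close> is known to be
    measurable, so \<open>E\<close> is rewritten through it.\<close>
  have "E = {s. s \<in> {0..\<delta>} \<and> indicator {0..T} s *\<^sub>R k s \<noteq> 0}"
    unfolding E_def using \<delta> by (auto simp: indicator_def)
  also have "\<dots> \<in> sets borel"
    using k unfolding set_borel_measurable_def by measurable
  finally have Em: "E \<in> sets borel" .
  have E0: "E \<in> null_sets lborel"
  proof -
    have "AE s in lborel. s \<notin> E" using k0 by eventually_elim (auto simp: E_def)
    then show ?thesis using Em by (subst (asm) AE_iff_null_sets[symmetric]) auto
  qed
  \<comment> \<open>Two versions are needed: the compensator integrates against
    \<open>lborel\<close>, whereas the intensity of the jumps lives on \<open>[0,T]\<close>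
    only.\<close>
  then have E1: "E \<in> null_sets (density lborel (indicator {0..T}))"
  proof (subst null_sets_density_iff)
    show "E \<in> sets lborel \<and> (AE x in lborel. x \<in> E \<longrightarrow> indicator {0..T} x = (0::ennreal))"
      using Em AE_not_in[OF E0] by auto
  qed measurable
  have k': "k s = 0" if "s \<in> {0<..\<delta>}" "s \<notin> E" for s using that unfolding E_def by auto
  have Nn: "AE \<omega> in M. E \<times> UNIV \<in> null_sets (jump_measure T L \<omega>)"
    by (rule poisson_random_measure_null[OF M N null_sets_times_UNIV[OF sf sn E1]])
  obtain J where J: "compensated_integral M T G (jump_measure T L) \<nu> (\<lambda>s z. k s * z) J"
    and ZJ: "AE \<omega> in M. \<forall>t\<in>{0..T}. Z t \<omega> = J t \<omega> +
             (LINT p:({0<..t} \<times> {z. 1 < \<bar>z\<bar>})|jump_measure T L \<omega>. k (fst p) * snd p)"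
    using Z unfolding is_levy_integral_def by blast
  have "AE \<omega> in M. \<forall>t\<in>{0..\<delta>}. J t \<omega> = 0"
  proof (rule AE_cadlag_zero)
    show "cadlag_on T (\<lambda>t. J t \<omega>)" if "\<omega> \<in> space M" for \<omega>
      using J that unfolding compensated_integral_def by blast
    fix t assume t: "t \<in> {0..\<delta>}"
    let ?I = "\<lambda>\<epsilon> \<omega>. truncated_compensated_integral (jump_measure T L \<omega>) \<nu> (\<lambda>s z. k s * z) \<epsilon> t"
    \<comment> \<open>The exceptional set is the one of \<open>Nn\<close>, so it serves all of the
      uncountably many thresholds at once.\<close>
    have I0: "AE \<omega> in M. \<forall>\<epsilon>. ?I \<epsilon> \<omega> = 0"
      using Nn
    proof eventually_elim
      case (elim \<omega>)
      have "(LINT p:({0<..t} \<times> B)|jump_measure T L \<omega>. k (fst p) * snd p) = 0" for B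
        by (rule set_integral_vanishing_integrand[OF elim, where \<delta> = \<delta>]) (use t k' in auto)
      moreover have "(LINT p:({0<..t} \<times> B)|(lborel \<Otimes>\<^sub>M \<nu>). k (fst p) * snd p) = 0" for B
        by (rule set_integral_vanishing_integrand[OF null_sets_times_UNIV[OF sf sn E0], where \<delta> = \<delta>])
          (use t k' in auto)
      ultimately show ?case unfolding truncated_compensated_integral_def by simp
    qed
    show "AE \<omega> in M. J t \<omega> = 0"
    proof (rule tendsto_in_prob_limit_zero[where Z = ?I and G = "at_right 0"])
      show "tendsto_in_prob M ?I (J t) (at_right 0)"
        using J t \<delta> unfolding compensated_integral_def by auto
      fix \<eta> :: real assume \<eta>: "\<eta> > 0"
      \<comment> \<open>Measurability of \<open>?I \<epsilon>\<close> is known only eventually;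
        comparison with the empty set settles every \<open>\<epsilon>\<close>.\<close>
      have "measure M {\<omega>\<in>space M. \<bar>?I \<epsilon> \<omega>\<bar> > \<eta>} \<le> measure M {}" for \<epsilon>
      proof (rule finite_measure_mono_AE)
        show "AE \<omega> in M. \<omega> \<in> {\<omega>\<in>space M. \<bar>?I \<epsilon> \<omega>\<bar> > \<eta>} \<longrightarrow> \<omega> \<in> {}"
          using I0 by eventually_elim (use \<eta> in auto)
      qed simp
      then have "measure M {\<omega>\<in>space M. \<bar>?I \<epsilon> \<omega>\<bar> > \<eta>} = 0" for \<epsilon>
        by (simp add: measure_le_0_iff)
      then show "((\<lambda>\<epsilon>. measure M {\<omega>\<in>space M. \<bar>?I \<epsilon> \<omega>\<bar> > \<eta>}) \<longlongrightarrow> 0) (at_right 0)" by simp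
    qed (auto intro: finite_measure_axioms)
  qed (use \<delta> in auto)
  with ZJ Nn show ?thesis
  proof eventually_elim
    case (elim \<omega>)
    show ?case
    proof
      fix t assume t: "t \<in> {0..\<delta>}"
      then have "(LINT p:({0<..t} \<times> {z. 1 < \<bar>z\<bar>})|jump_measure T L \<omega>. k (fst p) * snd p) = 0"
        by (intro set_integral_vanishing_integrand[OF elim(2), where \<delta> = \<delta>]) (use k' in auto)
      then show "Z t \<omega> = 0" using elim(1,3) t \<delta> by auto
    qed
  qed
qed

text \<open>The difference of two solutions is at most the integral of \<open>\<bar>h\<bar>\<close>,
  and \<open>\<bar>h\<bar>\<close> is at most \<open>K\<close> times the difference. Iterating the
  two bounds produces terms of an exponential series, which tend to 0.\<close>

lemma caratheodory_solution_unique: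
  fixes b :: "real \<Rightarrow> real \<Rightarrow> real"
  assumes lip: "\<And>t. t \<in> {0..\<delta>} \<Longrightarrow> K-lipschitz_on UNIV (b t)"
    and fi: "set_integrable lborel {0..\<delta>} (\<lambda>s. b s (f s))"
    and gi: "set_integrable lborel {0..\<delta>} (\<lambda>s. b s (g s))"
    and f: "\<And>t. t \<in> {0..\<delta>} \<Longrightarrow> f t = x + (LINT s:{0..t}|lborel. b s (f s))"
    and g: "\<And>t. t \<in> {0..\<delta>} \<Longrightarrow> g t = x + (LINT s:{0..t}|lborel. b s (g s))"
    and t: "t \<in> {0..\<delta>}"
  shows "f t = g t"
proof -
  define h where "h s = b s (f s) - b s (g s)" for s
  \<comment> \<open>The total mass of \<open>\<bar>h\<bar>\<close> starts the iteration, in place of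
    a supremum of \<open>\<bar>f - g\<bar>\<close>.\<close>
  define C where "C = (LINT s:{0..\<delta>}|lborel. \<bar>h s\<bar>)"
  have K: "K \<ge> 0" using lip[OF t] by (rule lipschitz_on_nonneg)
  have sub: "set_integrable lborel {0..u} q" if "set_integrable lborel {0..\<delta>} q" "u \<in> {0..\<delta>}"
    for u and q :: "real \<Rightarrow> real"
    by (rule set_integrable_subset[OF that(1)]) (use that in auto)
  have hi: "set_integrable lborel {0..\<delta>} h" unfolding h_def using fi gi by (rule set_integral_diff)
  have hai: "set_integrable lborel {0..\<delta>} (\<lambda>s. \<bar>h s\<bar>)" using hi by (rule set_integrable_abs)
  have C: "C \<ge> 0" unfolding C_def set_lebesgue_integral_def by (intro integral_nonneg_AE) auto
  have diff: "\<bar>f u - g u\<bar> \<le> (LINT s:{0..u}|lborel. \<bar>h s\<bar>)" if u: "u \<in> {0..\<delta>}" for u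
  proof -
    have "f u - g u = (LINT s:{0..u}|lborel. h s)"
      using f[OF u] g[OF u] set_integral_diff(2)[OF sub[OF fi u] sub[OF gi u]] unfolding h_def by simp
    then show ?thesis using set_integral_norm_bound[OF sub[OF hi u]] by simp
  qed
  \<comment> \<open>Picard iteration in place of Gronwall: it needs no measurability of \<open>f - g\<close>.\<close>
  have bound: "u \<in> {0..\<delta>} \<Longrightarrow> \<bar>f u - g u\<bar> \<le> C * (K * u) ^ n / fact n" for n u
  proof (induction n arbitrary: u)
    case 0
    have "(LINT s:{0..u}|lborel. \<bar>h s\<bar>) \<le> C"
      unfolding C_def set_lebesgue_integral_def
      using hai sub[OF hai 0] 0 unfolding set_integrable_def
      by (intro integral_mono) (auto simp: indicator_def)
    then show ?case using diff[OF 0] by simp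
  next
    case (Suc n)
    have "\<bar>f u - g u\<bar> \<le> (LINT s:{0..u}|lborel. \<bar>h s\<bar>)" by (rule diff[OF Suc.prems])
    also have "\<dots> \<le> (LINT s:{0..u}|lborel. (K * C * K ^ n / fact n) * s ^ n)"
    proof (rule set_integral_mono)
      show "set_integrable lborel {0..u} (\<lambda>s. \<bar>h s\<bar>)" by (rule sub[OF hai Suc.prems])
      show "set_integrable lborel {0..u} (\<lambda>s. (K * C * K ^ n / fact n) * s ^ n)"
        by (rule borel_integrable_atLeastAtMost') (intro continuous_intros)
      fix s assume "s \<in> {0..u}"
      then have s: "s \<in> {0..\<delta>}" using Suc.prems by auto
      have "\<bar>h s\<bar> \<le> K * \<bar>f s - g s\<bar>"
        using lipschitz_onD[OF lip[OF s], of "f s" "g s"] unfolding h_def by (simp add: dist_real_def)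
      also have "\<dots> \<le> K * (C * (K * s) ^ n / fact n)"
        by (rule mult_left_mono[OF Suc.IH[OF s] K])
      finally show "\<bar>h s\<bar> \<le> (K * C * K ^ n / fact n) * s ^ n"
        by (simp add: power_mult_distrib mult_ac)
    qed
    also have "\<dots> = (K * C * K ^ n / fact n) * (LINT s:{0..u}|lborel. s ^ n)"
      by simp
    also have "(LINT s:{0..u}|lborel. s ^ n) = u ^ Suc n / Suc n"
      using integral_power[of 0 u n] Suc.prems unfolding set_lebesgue_integral_def
      by (simp add: mult.commute)
    also have "(K * C * K ^ n / fact n) * (u ^ Suc n / Suc n) = C * (K * u) ^ Suc n / fact (Suc n)"
      by (simp add: power_mult_distrib field_simps)
    finally show ?case .
  qed
  have "(\<lambda>n. C * ((K * t) ^ n / fact n)) \<longlonglongrightarrow> C * 0"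
    using summable_LIMSEQ_zero[OF summable_exp[of "K * t"]]
    by (intro tendsto_mult tendsto_const) (simp add: divide_inverse mult.commute)
  then have "\<bar>f t - g t\<bar> \<le> C * 0"
    by (rule LIMSEQ_le_const) (use bound[OF t] in auto)
  then show ?thesis by simp
qed

section \<open>The law of the running supremum\<close>

lemma SUP_atLeastAtMost_split:
  fixes f :: "real \<Rightarrow> real"
  assumes "a \<le> c" "c \<le> d" and bdd: "bdd_above (f ` {a..d})"
  shows "(SUP s\<in>{a..d}. f s) = max (SUP s\<in>{a..c}. f s) (SUP s\<in>{c..d}. f s)"
proof -
  have "{a..d} = {a..c} \<union> {c..d}" using assms by auto
  moreover have "bdd_above (f ` {a..c})" "bdd_above (f ` {c..d})"
    by (rule bdd_above_mono[OF bdd], use assms in auto)+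
  ultimately show ?thesis
    using assms by (simp add: cSUP_union sup_max)
qed

text \<open>Splitting by whether \<open>Y\<close> exceeds \<open>m\<close> separates atom and
  density: ties \<open>Y = m\<close> go to the atom, and above \<open>m\<close> the maximum is
  \<open>Y\<close> itself.\<close>

lemma emeasure_distr_max_const:
  fixes Y :: "'a \<Rightarrow> real"
  assumes Z: "Z \<in> borel_measurable M" and ZY: "AE \<omega> in M. Z \<omega> = max m (Y \<omega>)"
    and f: "distributed M lborel Y f" and A: "A \<in> sets borel"
  shows "emeasure (distr M borel Z) A =
    emeasure M {\<omega>\<in>space M. Y \<omega> \<le> m} * emeasure (return borel m) A +
    emeasure (density lborel (\<lambda>y. f y * indicator {m<..} y)) A"
proof -
  have [measurable]: "Z \<in> borel_measurable M" "A \<in> sets borel" by fact+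
  have [measurable]: "Y \<in> borel_measurable M" using distributed_measurable[OF f] by simp
  have fm[measurable]: "f \<in> borel_measurable borel" using distributed_borel_measurable[OF f] by simp
  let ?P = "{\<omega>\<in>space M. Y \<omega> \<le> m \<and> m \<in> A}" and ?Q = "{\<omega>\<in>space M. Y \<omega> \<in> A \<inter> {m<..}}"
  have "emeasure (distr M borel Z) A = emeasure M (Z -` A \<inter> space M)" by (rule emeasure_distr) auto
  also have "\<dots> = emeasure M (?P \<union> ?Q)"
  proof (rule emeasure_eq_AE)
    show "AE \<omega> in M. \<omega> \<in> Z -` A \<inter> space M \<longleftrightarrow> \<omega> \<in> ?P \<union> ?Q"
      using ZY by eventually_elim (auto simp: max_def split: if_splits)
  qed auto
  also have "\<dots> = emeasure M ?P + emeasure M ?Q"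
    by (rule plus_emeasure[symmetric]) auto
  also have "emeasure M ?P = emeasure M {\<omega>\<in>space M. Y \<omega> \<le> m} * emeasure (return borel m) A"
    by (cases "m \<in> A") auto
  also have "emeasure M ?Q = emeasure (density lborel (\<lambda>y. f y * indicator {m<..} y)) A"
  proof -
    have "?Q = Y -` (A \<inter> {m<..}) \<inter> space M" by auto
    then have "emeasure M ?Q = (\<integral>\<^sup>+y. f y * indicator (A \<inter> {m<..}) y \<partial>lborel)"
      using distributed_emeasure[OF f, of "A \<inter> {m<..}"] by simp
    also have "\<dots> = (\<integral>\<^sup>+y. f y * indicator {m<..} y * indicator A y \<partial>lborel)"
      by (intro nn_integral_cong) (auto simp: indicator_def)
    also have "\<dots> = emeasure (density lborel (\<lambda>y. f y * indicator {m<..} y)) A"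
      by (rule emeasure_density[symmetric]) auto
    finally show ?thesis .
  qed
  finally show ?thesis .
qed

theorem mainTheorem4:
  fixes M :: "'a measure" and F :: "real \<Rightarrow> 'a measure"
    and W L X :: "real \<Rightarrow> 'a \<Rightarrow> real" and \<nu> :: "real measure"
    and b \<sigma> :: "real \<Rightarrow> real \<Rightarrow> real" and \<kappa> :: "real \<Rightarrow> real"
    and T \<delta> x :: real
  assumes "0 < T"
    and "filtered_prob_space M T F"
    and "brownian_motion M T F W"
    and "pure_jump_levy_process M T F \<nu> L"
    and "prob_space.indep_var M
           (\<Pi>\<^sub>M t\<in>{0..T}. borel) (\<lambda>\<omega>. \<lambda>t\<in>{0..T}. W t \<omega>)
           (\<Pi>\<^sub>M t\<in>{0..T}. borel) (\<lambda>\<omega>. \<lambda>t\<in>{0..T}. L t \<omega>)"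
    and "bounded (\<kappa> ` {0..T})" and "set_borel_measurable borel {0..T} \<kappa>"
    and "\<exists>K. \<forall>t\<in>{0..T}. K-lipschitz_on UNIV (b t)"
    and "strong_solution M T W L \<nu> b \<sigma> \<kappa> x X"
    and "\<delta> \<in> {0<..<T}"
    and "AE t in lborel. t \<in> {0..\<delta>} \<longrightarrow> (\<forall>y. \<sigma> t y = 0)"
    and "AE t in lborel. t \<in> {0..\<delta>} \<longrightarrow> \<kappa> t = 0"
  defines "Y \<equiv> (\<lambda>\<omega>. SUP s\<in>{\<delta>..T}. X s \<omega>)"
    and "Xstar \<equiv> (\<lambda>\<omega>. SUP s\<in>{0..T}. X s \<omega>)"
  shows "\<exists>m\<^sub>0. (AE \<omega> in M. (SUP s\<in>{0..\<delta>}. X s \<omega>) = m\<^sub>0) \<and>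
           measure (distr M borel Xstar) {m\<^sub>0..} = 1 \<and>
           (\<forall>f\<^sub>Y. distributed M lborel Y f\<^sub>Y \<longrightarrow>
              (\<forall>A\<in>sets borel.
                 emeasure (distr M borel Xstar) A =
                   emeasure M {\<omega>\<in>space M. Y \<omega> \<le> m\<^sub>0} * emeasure (return borel m\<^sub>0) A +
                   emeasure (density lborel (\<lambda>y. f\<^sub>Y y * indicator {m\<^sub>0<..} y)) A))"
proof -
  interpret prob_space M using assms(2) unfolding filtered_prob_space_def by blast
  have \<delta>: "0 \<le> \<delta>" "\<delta> \<le> T" "0 \<le> T" using assms(10) by auto
  have Wa: "adapted_on T F W" and La: "adapted_on T F L" and \<nu>: "levy_measure \<nu>"
    and N: "poisson_random_measure M (jump_measure T L) (density lborel (indicator {0..T}) \<Otimes>\<^sub>M \<nu>)"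
    using assms(3,4) unfolding brownian_motion_def pure_jump_levy_process_def levy_process_def by auto
  let ?G = "driver_filtration M W L"
  have G: "filtered_prob_space M T ?G" by (rule filtered_prob_space_driver[OF assms(2) Wa La])
  have BM: "brownian_motion M T ?G W" by (rule brownian_motion_driver[OF assms(2,3) La])
  have ad: "adapted_on T ?G X" and cad: "\<And>\<omega>. \<omega> \<in> space M \<Longrightarrow> cadlag_on T (\<lambda>t. X t \<omega>)"
    and bi: "AE \<omega> in M. set_integrable lborel {0..T} (\<lambda>s. b s (X s \<omega>))"
    using assms(9) unfolding strong_solution_def by auto
  obtain I Z where I: "is_ito_integral M T ?G W (\<lambda>s \<omega>. \<sigma> s (X s \<omega>)) I"
    and Z: "is_levy_integral M T ?G \<nu> L \<kappa> Z"
    and eq: "AE \<omega> in M. \<forall>t\<in>{0..T}. X t \<omega> = x + (LINT s:{0..t}|lborel. b s (X s \<omega>)) + I t \<omega> + Z t \<omega>"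
    using assms(9) unfolding strong_solution_def by blast
  have I0: "AE \<omega> in M. \<forall>t\<in>{0..\<delta>}. I t \<omega> = 0"
  proof (rule ito_integral_zero[OF G BM I \<delta>(1,2)])
    show "AE s in lborel. s \<in> {0..\<delta>} \<longrightarrow> (\<forall>\<omega>. \<sigma> s (X s \<omega>) = 0)"
      using assms(11) by eventually_elim auto
  qed
  have Z0: "AE \<omega> in M. \<forall>t\<in>{0..\<delta>}. Z t \<omega> = 0"
    by (rule levy_integral_zero[OF prob_space_axioms \<nu> N Z assms(7) \<delta>(1,2) assms(12)])
  \<comment> \<open>These are the path properties that uniqueness for the drift equation asks for;
    the noise has already dropped out.\<close>
  define good where "good \<omega> \<longleftrightarrow> set_integrable lborel {0..\<delta>} (\<lambda>s. b s (X s \<omega>)) \<and>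
      (\<forall>t\<in>{0..\<delta>}. X t \<omega> = x + (LINT s:{0..t}|lborel. b s (X s \<omega>)))" for \<omega>
  have good: "AE \<omega> in M. good \<omega>"
    using bi eq I0 Z0
  proof eventually_elim
    case (elim \<omega>)
    have "set_integrable lborel {0..\<delta>} (\<lambda>s. b s (X s \<omega>))"
      by (rule set_integrable_subset[OF elim(1)]) (use \<delta> in auto)
    then show ?case using elim(2-4) \<delta> unfolding good_def by auto
  qed
  obtain K where K: "\<And>t. t \<in> {0..T} \<Longrightarrow> K-lipschitz_on UNIV (b t)" using assms(8) by blast
  \<comment> \<open>A property that holds almost surely in a probability space has a witness. Its
    path is the reference whose supremum is the constant; all other good paths coincide with it on
    \<open>[0,\<delta>]\<close>.\<close>
  obtain \<omega>\<^sub>0 where \<omega>\<^sub>0: "good \<omega>\<^sub>0"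
    using AE_False good by (metis (mono_tags, lifting) eventually_mono)
  define m where "m = (SUP s\<in>{0..\<delta>}. X s \<omega>\<^sub>0)"
  have m: "AE \<omega> in M. (SUP s\<in>{0..\<delta>}. X s \<omega>) = m"
    using good
  proof eventually_elim
    case (elim \<omega>)
    have "X t \<omega> = X t \<omega>\<^sub>0" if "t \<in> {0..\<delta>}" for t
      by (rule caratheodory_solution_unique[where b = b and K = K and x = x and \<delta> = \<delta>])
        (use elim \<omega>\<^sub>0 K \<delta> that in \<open>auto simp: good_def\<close>)
    then show ?case unfolding m_def by (intro SUP_cong) auto
  qed
  have Xm: "X s \<in> borel_measurable M" if "s \<in> {0..T}" for s
    using ad G that unfolding adapted_on_def filtered_prob_space_def
    by (blast intro: measurable_from_subalg)
  have Xstar: "Xstar \<in> borel_measurable M"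
    unfolding Xstar_def by (rule borel_measurable_SUP_cadlag[OF Xm cad]) (use \<delta> in auto)
  \<comment> \<open>The split at \<open>\<delta>\<close> holds on every path, as cadlag paths are
    bounded; only the replacement of the first supremum by \<open>m\<close> is almost sure.\<close>
  have max: "AE \<omega> in M. Xstar \<omega> = max m (Y \<omega>)"
    using m
  proof (rule AE_mp, intro AE_I2 impI)
    fix \<omega> assume \<omega>: "\<omega> \<in> space M" and *: "(SUP s\<in>{0..\<delta>}. X s \<omega>) = m"
    show "Xstar \<omega> = max m (Y \<omega>)"
      unfolding Xstar_def Y_def *[symmetric]
      by (rule SUP_atLeastAtMost_split[OF \<delta>(1,2)])
        (rule bounded_imp_bdd_above[OF cadlag_on_bounded[OF cad[OF \<omega>]]])
  qed
  have "measure (distr M borel Xstar) {m..} = prob {\<omega>\<in>space M. m \<le> Xstar \<omega>}"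
    using Xstar by (subst measure_distr) (auto intro!: arg_cong[where f = prob])
  also have "\<dots> = 1"
    using max Xstar by (subst prob_Collect_eq_1) auto
  finally show ?thesis
    using m emeasure_distr_max_const[OF Xstar max] by blast
qed

end
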